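(* Under the nonparametric assumption, minimizing $\mathcal R_z$ with respect to $I$ will keep the equilibrium of the adversarial game $\mathcal L_{xz}$. Similarly, minimizing $\mathcal R_y$ with respect to $C$ will keep the equilibrium of the adversarial game $\mathcal L_{xy}$ unchanged.
   Context: Setting (structured generative adversarial networks). Data $x$ are assumed to be generated from two independent latent variables: $y$, encoding designated semantics (e.g. a class label), and $z$, encoding all other factors of variation. Let $p(x)$ be the true data distribution, $p(x,y)$ the true joint distribution of data and semantics, and $p(y)$, $p(z)$ known priors for $y$ and $z$. Networks. The generator $G$ takes $(y,z)$ as input and outputs a sample $x\sim p_g(x|y,z)=G(y,z)$. It induces $$p_g(x|z)=\int p(y)\,p_g(x|y,z)\,dy,\qquad p_g(x|y)=\int p(z)\,p_g(x|y,z)\,dz,$$ and the joint distributions $p_g(x,z)=p(z)\,p_g(x|z)$ and $p_g(x,y)=p(y)\,p_g(x|y)$. The inference network $I$ maps $x$ to $z$ and defines a conditional distribution $z\sim p_i(z|x)=I(x)$, with joint $p_i(x,z)=p(x)\,p_i(z|x)$. The inference network $C$ maps $x$ to $y$ and defines a conditional distribution $y\sim p_c(y|x)=C(x)$. The critics (discriminators) $D_{xz}$ and $D_{xy}$ take pairs $(x,z)$ and $(x,y)$ respectively. Nonparametric assumption: the networks are not restricted by a finite-capacity parametrization, i.e. the distributions and critics they represent may be arbitrary. Adversarial games. $$\min_{I,G}\max_{D_{xz}}\ \mathcal L_{xz}=\mathbb E_{x\sim p(x)}[\log D_{xz}(x,I(x))]+\mathbb E_{z\sim p(z),\,y\sim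 p(y)}[\log(1-D_{xz}(G(y,z),z))],$$ $$\min_{G}\max_{D_{xy}}\ \mathcal L_{xy}=\mathbb E_{(x,y)\sim p(x,y)}[\log D_{xy}(x,y)]+\mathbb E_{y\sim p(y),\,z\sim p(z)}[\log(1-D_{xy}(G(y,z),y))].$$ The equilibrium of each game is the one at which the global minimum of the inner maximum is attained: for $\mathcal L_{xz}$ the global minimum of $\max_{D_{xz}}\mathcal L_{xz}$ is achieved if and only if $p(x)\,p_i(z|x)=p(z)\,p_g(x|z)$, where the optimal critic is $D^*_{xz}=\tfrac12$; for $\mathcal L_{xy}$ the global minimum of $\max_{D_{xy}}\mathcal L_{xy}$ is achieved if and only if $p(x,y)=p(y)\,p_g(x|y)$, where the optimal critic is $D^*_{xy}=\tfrac12$. Collaborative (reconstruction) objectives. $$\mathcal R_z=-\mathbb E_{(x,z)\sim p_g(x,z)}[\log p_i(z|x)],$$ $$\mathcal R_y=-\mathbb E_{(x,y)\sim p(x,y)}[\log p_c(y|x)]-\mathbb E_{(x,y)\sim p_g(x,y)}[\log p_c(y|x)].$$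
   Formalization: That a minimizing I (or C) preserves the equilibrium is asserted only when the minimal value of R_z (or R_y) is finite; if, e.g., the conditional entropy is infinite, every I minimizes R_z and the claim fails. *)

theory Defs
  imports "HOL-Probability.Probability"
begin

text \<open>
  Conventions. X, Y, Z are the spaces of data, semantics and remaining factors; Y and Z are
  reference (sigma-finite) measures, with respect to which the conditional densities
  p_c(y|x) and p_i(z|x) are taken, so that discrete and continuous latent variables are both
  covered. X is used as a measurable space only. The generator is a Markov kernel, which
  covers deterministic generators as well as densities p_g(x|y,z).
\<close>

definition elog :: "real \<Rightarrow> ereal" where
  "elog t = (if t \<le> 0 then -\<infinity> else ereal (ln t))"

text \<open>Expectation with values in the extended reals. Where the positive and the negative part
  are both infinite, the value is \<open>\<infinity>\<close> (in \<^typ>\<open>ereal\<close>, \<open>\<infinity> - \<infinity> = \<infinity>\<close>).\<close>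

definition eexpect :: "'a measure \<Rightarrow> ('a \<Rightarrow> ereal) \<Rightarrow> ereal" where
  "eexpect M f =
     enn2ereal (\<integral>\<^sup>+w. e2ennreal (f w) \<partial>M) - enn2ereal (\<integral>\<^sup>+w. e2ennreal (- f w) \<partial>M)"


text \<open>Nonparametric assumption: the networks range over all objects of the given kind.\<close>

definition generators :: "'x measure \<Rightarrow> 'y measure \<Rightarrow> 'z measure \<Rightarrow> ('y \<times> 'z \<Rightarrow> 'x measure) set" where
  "generators X Y Z = measurable (Y \<Otimes>\<^sub>M Z) (prob_algebra X)"

definition cond_densities :: "'a measure \<Rightarrow> 'b measure \<Rightarrow> ('a \<Rightarrow> 'b \<Rightarrow> real) set" where
  "cond_densities A B =
     {f. (\<lambda>(a, b). f a b) \<in> borel_measurable (A \<Otimes>\<^sub>M B) \<and>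
         (\<forall>a\<in>space A. (\<forall>b\<in>space B. 0 \<le> f a b) \<and> (\<integral>\<^sup>+b. ennreal (f a b) \<partial>B) = 1)}"

definition critics :: "'a measure \<Rightarrow> ('a \<Rightarrow> real) set" where
  "critics A = {D \<in> borel_measurable A. \<forall>w\<in>space A. 0 \<le> D w \<and> D w \<le> 1}"


text \<open>\<open>joint_density A B f\<close> is the law with density f(b|a) with respect to A and B,
  for instance p(x) p_i(z|x).\<close>

definition joint_density ::
  "'a measure \<Rightarrow> 'b measure \<Rightarrow> ('a \<Rightarrow> 'b \<Rightarrow> real) \<Rightarrow> ('a \<times> 'b) measure" where
  "joint_density A B f = density (A \<Otimes>\<^sub>M B) (\<lambda>(a, b). ennreal (f a b))"

definition gen_x_given_z :: "'y measure \<Rightarrow> ('y \<times> 'z \<Rightarrow> 'x measure) \<Rightarrow> 'z \<Rightarrow> 'x measure" where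
  "gen_x_given_z py G z = bind py (\<lambda>y. G (y, z))"

definition gen_x_given_y :: "'z measure \<Rightarrow> ('y \<times> 'z \<Rightarrow> 'x measure) \<Rightarrow> 'y \<Rightarrow> 'x measure" where
  "gen_x_given_y pz G y = bind pz (\<lambda>z. G (y, z))"

definition gen_xz ::
  "'x measure \<Rightarrow> 'z measure \<Rightarrow> 'y measure \<Rightarrow> 'z measure \<Rightarrow>
   ('y \<times> 'z \<Rightarrow> 'x measure) \<Rightarrow> ('x \<times> 'z) measure" where
  "gen_xz X Z py pz G =
     bind pz (\<lambda>z. distr (gen_x_given_z py G z) (X \<Otimes>\<^sub>M Z) (\<lambda>x. (x, z)))"

definition gen_xy ::
  "'x measure \<Rightarrow> 'y measure \<Rightarrow> 'y measure \<Rightarrow> 'z measure \<Rightarrow>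
   ('y \<times> 'z \<Rightarrow> 'x measure) \<Rightarrow> ('x \<times> 'y) measure" where
  "gen_xy X Y py pz G =
     bind py (\<lambda>y. distr (gen_x_given_y pz G y) (X \<Otimes>\<^sub>M Y) (\<lambda>x. (x, y)))"


definition L_xz ::
  "'z measure \<Rightarrow> 'x measure \<Rightarrow> 'y measure \<Rightarrow> 'z measure \<Rightarrow>
   ('x \<Rightarrow> 'z \<Rightarrow> real) \<Rightarrow> ('y \<times> 'z \<Rightarrow> 'x measure) \<Rightarrow> ('x \<times> 'z \<Rightarrow> real) \<Rightarrow> ereal" where
  "L_xz Z px py pz I G D =
     eexpect px (\<lambda>x. eexpect (density Z (\<lambda>z. ennreal (I x z))) (\<lambda>z. elog (D (x, z)))) +
     eexpect (py \<Otimes>\<^sub>M pz) (\<lambda>(y, z). eexpect (G (y, z)) (\<lambda>x. elog (1 - D (x, z))))"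

definition L_xy ::
  "('x \<times> 'y) measure \<Rightarrow> 'y measure \<Rightarrow> 'z measure \<Rightarrow>
   ('y \<times> 'z \<Rightarrow> 'x measure) \<Rightarrow> ('x \<times> 'y \<Rightarrow> real) \<Rightarrow> ereal" where
  "L_xy pxy py pz G D =
     eexpect pxy (\<lambda>(x, y). elog (D (x, y))) +
     eexpect (py \<Otimes>\<^sub>M pz) (\<lambda>(y, z). eexpect (G (y, z)) (\<lambda>x. elog (1 - D (x, y))))"

text \<open>An equilibrium consists of networks attaining the global minimum of the inner maximum,
  together with an optimal critic.\<close>

definition equilibrium_xz ::
  "'x measure \<Rightarrow> 'y measure \<Rightarrow> 'z measure \<Rightarrow> 'x measure \<Rightarrow> 'y measure \<Rightarrow> 'z measure \<Rightarrow>
   ('x \<Rightarrow> 'z \<Rightarrow> real) \<Rightarrow> ('y \<times> 'z \<Rightarrow> 'x measure) \<Rightarrow> ('x \<times> 'z \<Rightarrow> real) \<Rightarrow> bool" where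
  "equilibrium_xz X Y Z px py pz I G D \<longleftrightarrow>
     is_arg_min (\<lambda>(I, G). SUP D\<in>critics (X \<Otimes>\<^sub>M Z). L_xz Z px py pz I G D)
       (\<lambda>(I, G). I \<in> cond_densities X Z \<and> G \<in> generators X Y Z) (I, G) \<and>
     is_arg_max (L_xz Z px py pz I G) (\<lambda>D. D \<in> critics (X \<Otimes>\<^sub>M Z)) D"

definition equilibrium_xy ::
  "'x measure \<Rightarrow> 'y measure \<Rightarrow> 'z measure \<Rightarrow> ('x \<times> 'y) measure \<Rightarrow> 'y measure \<Rightarrow> 'z measure \<Rightarrow>
   ('y \<times> 'z \<Rightarrow> 'x measure) \<Rightarrow> ('x \<times> 'y \<Rightarrow> real) \<Rightarrow> bool" where
  "equilibrium_xy X Y Z pxy py pz G D \<longleftrightarrow>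
     is_arg_min (\<lambda>G. SUP D\<in>critics (X \<Otimes>\<^sub>M Y). L_xy pxy py pz G D)
       (\<lambda>G. G \<in> generators X Y Z) G \<and>
     is_arg_max (L_xy pxy py pz G) (\<lambda>D. D \<in> critics (X \<Otimes>\<^sub>M Y)) D"


text \<open>The minus sign is kept inside the expectations: an objective to be minimized is then
  \<open>\<infinity>\<close>, never \<open>-\<infinity>\<close>, where the expectation is undefined.\<close>

definition R_z ::
  "'x measure \<Rightarrow> 'z measure \<Rightarrow> 'y measure \<Rightarrow> 'z measure \<Rightarrow>
   ('x \<Rightarrow> 'z \<Rightarrow> real) \<Rightarrow> ('y \<times> 'z \<Rightarrow> 'x measure) \<Rightarrow> ereal" where
  "R_z X Z py pz I G = eexpect (gen_xz X Z py pz G) (\<lambda>(x, z). - elog (I x z))"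

definition R_y ::
  "'x measure \<Rightarrow> 'y measure \<Rightarrow> ('x \<times> 'y) measure \<Rightarrow> 'y measure \<Rightarrow> 'z measure \<Rightarrow>
   ('x \<Rightarrow> 'y \<Rightarrow> real) \<Rightarrow> ('y \<times> 'z \<Rightarrow> 'x measure) \<Rightarrow> ereal" where
  "R_y X Y pxy py pz C G =
     eexpect pxy (\<lambda>(x, y). - elog (C x y)) +
     eexpect (gen_xy X Y py pz G) (\<lambda>(x, y). - elog (C x y))"

definition minimizes_R_z ::
  "'x measure \<Rightarrow> 'z measure \<Rightarrow> 'y measure \<Rightarrow> 'z measure \<Rightarrow>
   ('y \<times> 'z \<Rightarrow> 'x measure) \<Rightarrow> ('x \<Rightarrow> 'z \<Rightarrow> real) \<Rightarrow> bool" where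
  "minimizes_R_z X Z py pz G =
     is_arg_min (\<lambda>I. R_z X Z py pz I G) (\<lambda>I. I \<in> cond_densities X Z)"

definition minimizes_R_y ::
  "'x measure \<Rightarrow> 'y measure \<Rightarrow> ('x \<times> 'y) measure \<Rightarrow> 'y measure \<Rightarrow> 'z measure \<Rightarrow>
   ('y \<times> 'z \<Rightarrow> 'x measure) \<Rightarrow> ('x \<Rightarrow> 'y \<Rightarrow> real) \<Rightarrow> bool" where
  "minimizes_R_y X Y pxy py pz G =
     is_arg_min (\<lambda>C. R_y X Y pxy py pz C G) (\<lambda>C. C \<in> cond_densities X Y)"


text \<open>The data are generated from independent y and z by an unknown kernel \<open>T\<close>, the true
  p(x|y,z); p(x,y) and p(x) are the resulting laws. The two absolute continuity assumptions say
  that p(z) and the posterior p(y|x) have densities; the second is automatic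
  if Y is the counting measure of a countable set of labels.\<close>

locale sgan_setting =
  fixes X :: "'x measure" and Y :: "'y measure" and Z :: "'z measure"
    and px :: "'x measure" and py :: "'y measure" and pz :: "'z measure"
    and pxy :: "('x \<times> 'y) measure" and T :: "'y \<times> 'z \<Rightarrow> 'x measure"
  assumes sigma_finite_Y: "sigma_finite_measure Y"
    and sigma_finite_Z: "sigma_finite_measure Z"
    and py: "py \<in> space (prob_algebra Y)"
    and pz: "pz \<in> space (prob_algebra Z)"
    and T: "T \<in> measurable (Y \<Otimes>\<^sub>M Z) (prob_algebra X)"
    and pxy: "pxy = gen_xy X Y py pz T"
    and px: "px = distr pxy X fst"
    and pz_density: "absolutely_continuous Z pz"
    and posterior_density: "absolutely_continuous (px \<Otimes>\<^sub>M Y) pxy"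

end

theory Submission
  imports Defs
begin

text \<open>
  For probability measures P and Q, the constant critic 1/2 has loss \<open>ln 4\<close>. If P = Q no critic
  does better, by \<open>t (1 - t) \<le> 1/4\<close>; if P(E) > Q(E), tilting the critic slightly towards E does better.
  Since P = Q can be attained in both games (by G = p(x), independent of (y, z), for \<open>L_xz\<close>, and by
  G = T for \<open>L_xy\<close>), the equilibria are exactly the configurations with equal joint laws, and they
  depend on I only through p(x) p_i(z|x). At an equilibrium the reconstruction objective is then the
  cross entropy relative to p(x) p_i(z|x), resp. twice that relative to p(x,y), so that Gibbs'
  inequality identifies its minimizers, and the equality case identifies their joint laws.
\<close>


text \<open>Two obstacles shape the argument. The true kernel \<open>T\<close> cannot serve as the
  witness for \<open>L_xz\<close>: \<open>I\<close> ranges over conditional densities with respect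
  to \<open>Z\<close>, and the true joint law of (x, z) may be singular to
  \<open>px \<Otimes>\<^sub>M Z\<close>, for instance when x determines a continuously distributed
  z. A generator that ignores its inputs avoids this, since the product law only asks for a density
  of p(z). The other obstacle is infinite values. A critic's loss is an unsigned integral, because
  -log D \<ge> 0 for D in [0, 1], and hence always meaningful. A cross entropy is not, since a
  density may exceed 1 and its logarithm has both signs. The inequality survives every infinite
  case, but the equality case does not: if the minimum is \<infinity>, every conditional density
  attains it and nothing follows about its joint law, and at -\<infinity> the values cannot be
  subtracted. Hence the finiteness conditions where a minimizer's joint law is identified.\<close>

section \<open>Critic losses for a pair of probability measures\<close>

text \<open>The value is \<infinity> for t \<le> 0, and the negative values of -log beyond t = 1 are
  cut off to 0; on [0, 1], where critics live, nothing is lost.\<close>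

definition log_loss :: "real \<Rightarrow> ennreal" where
  "log_loss t = e2ennreal (- elog t)"

text \<open>This is the negated value of a game with data law P and generated law Q, so a critic
  maximizing the game minimizes this loss.\<close>

definition gan_loss :: "'a measure \<Rightarrow> 'a measure \<Rightarrow> ('a \<Rightarrow> real) \<Rightarrow> ennreal" where
  "gan_loss P Q D = (\<integral>\<^sup>+w. log_loss (D w) \<partial>P) + (\<integral>\<^sup>+w. log_loss (1 - D w) \<partial>Q)"

lemma measurable_elog [measurable]: "elog \<in> borel_measurable borel"
  unfolding elog_def by measurable

lemma measurable_log_loss [measurable]: "log_loss \<in> borel_measurable borel"
  unfolding log_loss_def by measurable

lemma log_loss_pos: "0 < t \<Longrightarrow> log_loss t = ennreal (- ln t)"
  by (simp add: log_loss_def elog_def)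

lemma log_loss_nonpos: "t \<le> 0 \<Longrightarrow> log_loss t = \<top>"
  by (simp add: log_loss_def elog_def)

lemma elog_nonpos: "t \<le> 1 \<Longrightarrow> elog t \<le> 0"
  by (auto simp: elog_def)

lemma enn2ereal_log_loss: "t \<le> 1 \<Longrightarrow> - enn2ereal (log_loss t) = elog t"
  by (simp add: log_loss_def enn2ereal_e2ennreal elog_nonpos)

lemma eexpect_cong:
  "(\<And>w. w \<in> space M \<Longrightarrow> f w = g w) \<Longrightarrow> eexpect M f = eexpect M g"
  unfolding eexpect_def by (simp cong: nn_integral_cong)

lemma eexpect_uminus_enn2ereal:
  "eexpect M (\<lambda>w. - enn2ereal (f w)) = - enn2ereal (\<integral>\<^sup>+w. f w \<partial>M)"
  by (simp add: eexpect_def e2ennreal_neg zero_ennreal.rep_eq)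

lemma eexpect_elog:
  assumes "\<And>w. w \<in> space M \<Longrightarrow> D w \<le> 1"
  shows "eexpect M (\<lambda>w. elog (D w)) = - enn2ereal (\<integral>\<^sup>+w. log_loss (D w) \<partial>M)"
proof -
  have "eexpect M (\<lambda>w. elog (D w)) = eexpect M (\<lambda>w. - enn2ereal (log_loss (D w)))"
    by (intro eexpect_cong) (simp add: assms enn2ereal_log_loss)
  then show ?thesis
    by (simp add: eexpect_uminus_enn2ereal)
qed

text \<open>Both summands are at most 0, so the ambiguous sum of \<infinity> and -\<infinity> cannot
  arise.\<close>

lemma uminus_enn2ereal_add:
  "- enn2ereal a + - enn2ereal b = - enn2ereal (a + b)"
  by (cases "enn2ereal a"; cases "enn2ereal b") (use enn2ereal_nonneg[of a] enn2ereal_nonneg[of b] in \<open>simp_all add: plus_ennreal.rep_eq\<close>)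

lemma gan_loss_half:
  assumes "prob_space P" "prob_space Q"
  shows "gan_loss P Q (\<lambda>_. 1 / 2) = ennreal (ln 4)"
proof -
  have "ln (4::real) = ln 2 + ln 2"
    using ln_mult[of "2::real" 2] by simp
  moreover have "log_loss (1 / 2) = ennreal (ln 2)"
    by (simp add: log_loss_pos ln_div)
  ultimately show ?thesis
    using assms by (simp add: gan_loss_def prob_space.emeasure_space_1 flip: ennreal_plus)
qed

lemma half_in_critics: "(\<lambda>_. 1 / 2) \<in> critics M"
  by (simp add: critics_def)

lemma log_loss_add_ge:
  assumes "0 \<le> t" "t \<le> 1"
  shows "ennreal (ln 4) \<le> log_loss t + log_loss (1 - t)"
proof (cases "t = 0 \<or> t = 1")
  case True
  then show ?thesis by (auto simp: log_loss_nonpos)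
next
  case False
  then have t: "0 < t" "t < 1" using assms by auto
  have "0 \<le> (1 - 2 * t)\<^sup>2" by simp
  then have "4 * (t * (1 - t)) \<le> 1" by (simp add: power2_eq_square algebra_simps)
  then have "ln (4 * (t * (1 - t))) \<le> 0" using t by simp
  then have "ln 4 \<le> - ln t + - ln (1 - t)" using t by (simp add: ln_mult)
  then show ?thesis
    using t by (simp add: log_loss_pos ennreal_leI flip: ennreal_plus)
qed

lemma gan_loss_self_ge:
  assumes "prob_space P" and D: "D \<in> critics P"
  shows "ennreal (ln 4) \<le> gan_loss P P D"
proof -
  interpret prob_space P by fact
  have [measurable]: "D \<in> borel_measurable P" using D by (simp add: critics_def)
  have "ennreal (ln 4) = (\<integral>\<^sup>+w. ennreal (ln 4) \<partial>P)" by (simp add: emeasure_space_1)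
  also have "\<dots> \<le> (\<integral>\<^sup>+w. log_loss (D w) + log_loss (1 - D w) \<partial>P)"
    using D by (intro nn_integral_mono log_loss_add_ge) (auto simp: critics_def)
  also have "\<dots> = gan_loss P P D"
    unfolding gan_loss_def by (intro nn_integral_add) measurable
  finally show ?thesis .
qed

text \<open>For D equal to p on E and 1 - p elsewhere, 1 - D is the critic of the same shape with p
  and 1 - p exchanged. One formula \<open>*\<close> in a parameter s therefore yields both
  integrals, with s = p under P and s = 1 - p under Q.\<close>

lemma gan_loss_indicator_critic:
  assumes P: "prob_space P" and Q: "prob_space Q" and sets: "sets P = sets Q"
    and E: "E \<in> sets P" and p: "0 < p" "p < 1"
  shows "gan_loss P Q (\<lambda>w. if w \<in> E then p else 1 - p) =
    ennreal (- ln p * (1 + measure P E - measure Q E) - ln (1 - p) * (1 - measure P E + measure Q E))"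
proof -
  have *: "(\<integral>\<^sup>+w. log_loss (if w \<in> E then s else 1 - s) \<partial>R) =
      ennreal (- ln s * measure R E - ln (1 - s) * (1 - measure R E))"
    if "prob_space R" "E \<in> sets R" "0 < s" "s < 1" for R s
  proof -
    interpret R: prob_space R by fact
    have neg: "- ln s \<ge> 0" "- ln (1 - s) \<ge> 0" using that by auto
    have "(\<integral>\<^sup>+w. log_loss (if w \<in> E then s else 1 - s) \<partial>R) =
      (\<integral>\<^sup>+w. ennreal (- ln s) * indicator E w + ennreal (- ln (1 - s)) * indicator (space R - E) w \<partial>R)"
      using that by (intro nn_integral_cong) (auto simp: log_loss_pos)
    also have "\<dots> = ennreal (- ln s) * emeasure R E + ennreal (- ln (1 - s)) * emeasure R (space R - E)"
      using that by (simp add: nn_integral_add nn_integral_cmult)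
    also have "\<dots> = ennreal (- ln s * measure R E + - ln (1 - s) * (1 - measure R E))"
      using neg that
      by (simp add: R.emeasure_eq_measure R.prob_compl mult_nonpos_nonneg
          flip: ennreal_mult'' ennreal_plus)
    finally show ?thesis by simp
  qed
  have "1 - (if w \<in> E then p else 1 - p) = (if w \<in> E then 1 - p else 1 - (1 - p))" for w by simp
  then have "gan_loss P Q (\<lambda>w. if w \<in> E then p else 1 - p) =
      ennreal (- ln p * measure P E - ln (1 - p) * (1 - measure P E)) +
      ennreal (- ln (1 - p) * measure Q E - ln (1 - (1 - p)) * (1 - measure Q E))"
    unfolding gan_loss_def using *[OF P E p] *[OF Q, of "1 - p"] E p sets by simp
  also have "\<dots> = ennreal ((- ln p * measure P E - ln (1 - p) * (1 - measure P E)) +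
      (- ln (1 - p) * measure Q E - ln (1 - (1 - p)) * (1 - measure Q E)))"
  proof (intro ennreal_plus[symmetric])
    have l: "ln p \<le> 0" "ln (1 - p) \<le> 0" using p by auto
    show "0 \<le> - ln p * measure P E - ln (1 - p) * (1 - measure P E)"
      using mult_nonpos_nonneg[OF l(1), of "measure P E"] mult_nonpos_nonneg[OF l(2), of "1 - measure P E"]
        prob_space.prob_le_1[OF P, of E] by simp
    show "0 \<le> - ln (1 - p) * measure Q E - ln (1 - (1 - p)) * (1 - measure Q E)"
      using mult_nonpos_nonneg[OF l(2), of "measure Q E"] mult_nonpos_nonneg[OF l(1), of "1 - measure Q E"]
        prob_space.prob_le_1[OF Q, of E] by simp
  qed
  also have "\<dots> = ennreal (- ln p * (1 + measure P E - measure Q E) - ln (1 - p) * (1 - measure P E + measure Q E))"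
    by (simp add: algebra_simps)
  finally show ?thesis .
qed

lemma exists_better_critic:
  assumes P: "prob_space P" and Q: "prob_space Q" and sets: "sets P = sets Q" and "P \<noteq> Q"
  shows "\<exists>D\<in>critics P. gan_loss P Q D < ennreal (ln 4)"
proof -
  interpret P: prob_space P by fact
  interpret Q: prob_space Q by fact
  have sp: "space P = space Q" using sets by (rule sets_eq_imp_space_eq)
  obtain E where E: "E \<in> sets P" "measure P E > measure Q E"
  proof -
    obtain A where A: "A \<in> sets P" "measure P A \<noteq> measure Q A"
      using measure_eqI[OF sets] \<open>P \<noteq> Q\<close> by (auto simp: P.emeasure_eq_measure Q.emeasure_eq_measure)
    show ?thesis
    proof (cases "measure P A > measure Q A")
      case True
      then show ?thesis using A that by blast
    next
      case False
      \<comment> \<open>Both total masses are 1, so a deficit on A is an excess on its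
        complement.\<close>
      then have "measure P (space P - A) > measure Q (space P - A)"
        using A P.prob_compl[of A] Q.prob_compl[of A] sets sp by simp
      then show ?thesis using A that by blast
    qed
  qed
  \<comment> \<open>The loss of the tilted critic is minimal at t = d, but there the quadratic
    bounds below are too weak: in general they give a gain of 2 d t - 3 t^2 + d t^2, which is not
    positive at t = d. Halving makes it t^2 (1 + d), and also ensures t \<le> 1/2, as the bound for
    ln (1 - t) requires.\<close>
  define d t where "d = measure P E - measure Q E" and "t = d / 2"
  have d: "0 < d" "d \<le> 1" using E P.prob_le_1[of E] by (auto simp: d_def intro: order.trans[OF diff_mono[of _ 1 0]])
  have t: "0 < t" "t \<le> 1 / 2" "t < d" using d by (auto simp: t_def)
  define p where "p = (1 + t) / 2"
  have p: "0 < p" "p < 1" and p': "1 - p = (1 - t) / 2" using t by (auto simp: p_def field_simps)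
  have "ln (1 + t) \<ge> t - t\<^sup>2" using t by (intro ln_one_plus_pos_lower_bound) auto
  moreover have "ln (1 - t) \<ge> - t - 2 * t\<^sup>2" using t by (intro ln_one_minus_pos_lower_bound) auto
  ultimately have "(1 + d) * ln (1 + t) + (1 - d) * ln (1 - t) \<ge>
      (1 + d) * (t - t\<^sup>2) + (1 - d) * (- t - 2 * t\<^sup>2)"
    using d by (intro add_mono mult_left_mono) auto
  moreover have "(1 + d) * (t - t\<^sup>2) + (1 - d) * (- t - 2 * t\<^sup>2) = t\<^sup>2 * (1 + d)"
    by (simp add: t_def power2_eq_square field_simps)
  moreover have "t\<^sup>2 * (1 + d) > 0" using t d by simp
  ultimately have gain: "(1 + d) * ln (1 + t) + (1 - d) * ln (1 - t) > 0" by linarith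
  have "- ln p * (1 + d) - ln (1 - p) * (1 - d) =
      2 * ln 2 - ((1 + d) * ln (1 + t) + (1 - d) * ln (1 - t))"
    unfolding p' unfolding p_def using t by (simp add: ln_div algebra_simps)
  moreover have "ln (4::real) = 2 * ln 2" using ln_realpow[of 2 2] by simp
  ultimately have "- ln p * (1 + d) - ln (1 - p) * (1 - d) < ln 4" using gain by simp
  then have "gan_loss P Q (\<lambda>w. if w \<in> E then p else 1 - p) < ennreal (ln 4)"
    using gan_loss_indicator_critic[OF P Q sets E(1) p]
    by (simp add: d_def ennreal_lessI algebra_simps)
  moreover have "(\<lambda>w. if w \<in> E then p else 1 - p) \<in> critics P"
    using E p by (auto simp: critics_def)
  ultimately show ?thesis by blast
qed

text \<open>The constant critic 1/2 keeps the inner maximum at or above -ln 4 for every P and Q. An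
  inner maximum of at most -ln 4 says that no critic has loss below ln 4, which singles out P =
  Q.\<close>

lemma SUP_gan_le_iff:
  assumes P: "prob_space P" and Q: "prob_space Q" and sets: "sets P = sets M" "sets Q = sets M"
  shows "(SUP D\<in>critics M. - enn2ereal (gan_loss P Q D)) \<le> - ereal (ln 4) \<longleftrightarrow> P = Q"
    and "(SUP D\<in>critics M. - enn2ereal (gan_loss P Q D)) \<ge> - ereal (ln 4)"
proof -
  have crit: "critics M = critics P"
    using sets by (simp add: critics_def sets_eq_imp_space_eq[OF sets(1)] cong: measurable_cong_sets)
  have four: "enn2ereal (ennreal (ln 4)) = ereal (ln 4)" by (simp add: enn2ereal_ennreal)
  show "(SUP D\<in>critics M. - enn2ereal (gan_loss P Q D)) \<ge> - ereal (ln 4)"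
    by (rule SUP_upper2[OF half_in_critics]) (simp only: gan_loss_half[OF P Q] four)
  have "(SUP D\<in>critics M. - enn2ereal (gan_loss P Q D)) \<le> - ereal (ln 4) \<longleftrightarrow>
    (\<forall>D\<in>critics P. ennreal (ln 4) \<le> gan_loss P Q D)"
    by (simp add: SUP_le_iff crit less_eq_ennreal.rep_eq four del: uminus_ereal.simps)
  also have "\<dots> \<longleftrightarrow> P = Q"
    using exists_better_critic[OF P Q] gan_loss_self_ge[OF P] sets by (auto simp: not_le[symmetric])
  finally show "(SUP D\<in>critics M. - enn2ereal (gan_loss P Q D)) \<le> - ereal (ln 4) \<longleftrightarrow> P = Q" .
qed

text \<open>Common core of both games: s stands for the pair (I, G) in \<open>L_xz\<close> and for G
  in \<open>L_xy\<close>. The witness \<open>s0\<close> shows that the universal lower bound -ln 4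
  is the actual minimum, so that minimizers must reach it and have equal laws.\<close>

lemma is_arg_min_gan_iff:
  assumes "\<And>s. S s \<Longrightarrow> prob_space (P s) \<and> sets (P s) = sets M"
    and "\<And>s. S s \<Longrightarrow> prob_space (Q s) \<and> sets (Q s) = sets M"
    and F: "\<And>s. S s \<Longrightarrow> F s = (SUP D\<in>critics M. - enn2ereal (gan_loss (P s) (Q s) D))"
    and opt: "S s0" "P s0 = Q s0"
  shows "is_arg_min F S s \<longleftrightarrow> S s \<and> P s = Q s"
proof -
  have le: "F r \<le> - ereal (ln 4) \<longleftrightarrow> P r = Q r" and ge: "F r \<ge> - ereal (ln 4)" if "S r" for r
    using SUP_gan_le_iff[of "P r" "Q r" M] assms(1,2)[OF that] F[OF that] by auto
  show ?thesis
    unfolding is_arg_min_linorder using le ge opt by (metis order.trans)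
qed


section \<open>Gibbs' inequality for extended-valued cross entropies\<close>

lemma eexpect_uminus_elog:
  assumes [measurable]: "g \<in> borel_measurable P" and "AE w in P. 0 < g w"
  shows "eexpect P (\<lambda>w. - elog (g w)) =
    enn2ereal (\<integral>\<^sup>+w. ennreal (- ln (g w)) \<partial>P) - enn2ereal (\<integral>\<^sup>+w. ennreal (ln (g w)) \<partial>P)"
proof -
  have "(\<integral>\<^sup>+w. e2ennreal (- elog (g w)) \<partial>P) = (\<integral>\<^sup>+w. ennreal (- ln (g w)) \<partial>P)"
    using assms(2) by (intro nn_integral_cong_AE) (auto simp: elog_def)
  moreover have "(\<integral>\<^sup>+w. e2ennreal (- (- elog (g w))) \<partial>P) = (\<integral>\<^sup>+w. ennreal (ln (g w)) \<partial>P)"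
    using assms(2) by (intro nn_integral_cong_AE) (auto simp: elog_def)
  ultimately show ?thesis by (simp add: eexpect_def)
qed

lemma eexpect_uminus_elog_less_top:
  assumes [measurable]: "g \<in> borel_measurable P" and less: "eexpect P (\<lambda>w. - elog (g w)) < \<infinity>"
  shows "AE w in P. 0 < g w" and "(\<integral>\<^sup>+w. ennreal (- ln (g w)) \<partial>P) \<noteq> \<top>"
proof -
  \<comment> \<open>Since \<infinity> - \<infinity> = \<infinity>, a value below \<infinity> forces
    the first integral to be finite, whatever the second one is.\<close>
  have fin: "(\<integral>\<^sup>+w. log_loss (g w) \<partial>P) \<noteq> \<infinity>"
    using less by (auto simp: eexpect_def log_loss_def)
  then have "AE w in P. log_loss (g w) \<noteq> \<infinity>"
    by (intro nn_integral_PInf_AE) auto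
  then show pos: "AE w in P. 0 < g w"
    by eventually_elim (use log_loss_nonpos in \<open>force simp: not_le[symmetric]\<close>)
  have "(\<integral>\<^sup>+w. log_loss (g w) \<partial>P) = (\<integral>\<^sup>+w. ennreal (- ln (g w)) \<partial>P)"
    using pos by (intro nn_integral_cong_AE) (auto simp: log_loss_pos)
  then show "(\<integral>\<^sup>+w. ennreal (- ln (g w)) \<partial>P) \<noteq> \<top>"
    using fin by simp
qed

text \<open>The almost everywhere hypothesis is blind where f vanishes. The equal total masses close
  this gap: f \<le> g holds almost everywhere in M, and g - f has integral 0.\<close>

lemma density_eq_of_AE_eq:
  fixes f g :: "'a \<Rightarrow> real"
  assumes [measurable]: "f \<in> borel_measurable M" "g \<in> borel_measurable M"
    and nn: "\<And>x. x \<in> space M \<Longrightarrow> 0 \<le> f x" "\<And>x. x \<in> space M \<Longrightarrow> 0 \<le> g x"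
    and "(\<integral>\<^sup>+x. ennreal (f x) \<partial>M) = 1" "(\<integral>\<^sup>+x. ennreal (g x) \<partial>M) = 1"
    and eq: "AE x in density M (\<lambda>x. ennreal (f x)). f x = g x"
  shows "density M (\<lambda>x. ennreal (g x)) = density M (\<lambda>x. ennreal (f x))"
proof -
  have *: "AE x in M. 0 < f x \<longrightarrow> f x = g x"
    using eq by (simp add: AE_density)
  then have "AE x in M. ennreal (f x) \<le> ennreal (g x)"
    using AE_space by eventually_elim (use nn in \<open>force intro: ennreal_leI simp: le_less\<close>)
  then have "(\<integral>\<^sup>+x. ennreal (g x) - ennreal (f x) \<partial>M) = 0"
    using assms(5,6) by (subst nn_integral_diff) auto
  then have "AE x in M. ennreal (g x) - ennreal (f x) = 0"
    by (subst (asm) nn_integral_0_iff_AE) auto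
  with \<open>AE x in M. ennreal (f x) \<le> ennreal (g x)\<close> have "AE x in M. ennreal (g x) = ennreal (f x)"
    by eventually_elim (metis antisym diff_eq_0_iff_ennreal ennreal_less_top less_imp_le order.strict_iff_not)
  then show ?thesis by (intro density_cong) auto
qed

text \<open>The roles are asymmetric: f is the density of the law under which expectations are
  taken, g the competitor.\<close>

locale two_densities =
  fixes M :: "'a measure" and f g :: "'a \<Rightarrow> real"
  assumes f [measurable]: "f \<in> borel_measurable M" and g [measurable]: "g \<in> borel_measurable M"
    and f_nonneg: "\<And>x. x \<in> space M \<Longrightarrow> 0 \<le> f x" and g_nonneg: "\<And>x. x \<in> space M \<Longrightarrow> 0 \<le> g x"
    and f_1: "(\<integral>\<^sup>+x. ennreal (f x) \<partial>M) = 1" and g_1: "(\<integral>\<^sup>+x. ennreal (g x) \<partial>M) = 1"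
begin

definition P where "P = density M (\<lambda>x. ennreal (f x))"

lemma sets_P [measurable_cong]: "sets P = sets M" and space_P: "space P = space M"
  by (simp_all add: P_def)

sublocale P: prob_space P
  by (rule prob_spaceI) (simp add: P_def emeasure_density f_1 cong: nn_integral_cong_simp)

lemma AE_f_pos: "AE x in P. 0 < f x"
  unfolding P_def by (simp add: AE_density)

text \<open>Likelihood ratio. Division by zero gives 0 where f vanishes, a P-null set, so the
  integral of r under P is the mass that g puts on the set where f is positive; it can be less than
  1.\<close>

definition r where "r x = g x / f x"

lemma r_nonneg: "x \<in> space M \<Longrightarrow> 0 \<le> r x"
  by (simp add: r_def f_nonneg g_nonneg)

lemma measurable_r [measurable]: "r \<in> borel_measurable M"
  unfolding r_def by measurable

lemma nn_integral_r_le: "(\<integral>\<^sup>+x. ennreal (r x) \<partial>P) \<le> 1"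
proof -
  have "(\<integral>\<^sup>+x. ennreal (r x) \<partial>P) = (\<integral>\<^sup>+x. ennreal (f x) * ennreal (r x) \<partial>M)"
    unfolding P_def by (subst nn_integral_density) auto
  also have "\<dots> \<le> (\<integral>\<^sup>+x. ennreal (g x) \<partial>M)"
  proof (intro nn_integral_mono)
    fix x assume "x \<in> space M"
    then show "ennreal (f x) * ennreal (r x) \<le> ennreal (g x)"
      using f_nonneg[of x] g_nonneg[of x]
      by (cases "f x = 0") (auto simp: r_def simp flip: ennreal_mult)
  qed
  finally show ?thesis by (simp add: g_1)
qed

lemma integrable_r: "integrable P r" and integral_r_le: "(\<integral>x. r x \<partial>P) \<le> 1"
proof -
  have nn: "AE x in P. 0 \<le> r x"
    using AE_space by eventually_elim (simp add: space_P r_nonneg)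
  show *: "integrable P r"
    using nn_integral_r_le by (intro integrableI_nonneg nn) (auto simp: order.strict_trans1)
  have "ennreal (\<integral>x. r x \<partial>P) \<le> 1"
    using nn_integral_r_le nn_integral_eq_integral[OF * nn] by simp
  then show "(\<integral>x. r x \<partial>P) \<le> 1" by (simp add: ennreal_le_1)
qed

text \<open>All comparisons rest on \<open>ln g - ln f = ln r \<le> r - 1\<close>, where \<open>r = g / f\<close> is P-integrable with
  integral at most 1; the extended-valued cases use only that \<open>ln r\<close> has an integrable positive part.\<close>

lemma AE_ln_r:
  assumes "AE x in P. 0 < g x"
  shows "AE x in P. 0 < r x \<and> ln (r x) = ln (g x) - ln (f x) \<and> ln (r x) \<le> r x - 1"
  using assms AE_f_pos
proof eventually_elim
  case (elim x)
  then have "0 < r x" by (simp add: r_def)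
  then show ?case using elim ln_le_minus_one[of "r x"] by (simp add: r_def ln_div)
qed

text \<open>Both bounds rearrange ln g - ln f \<le> r, and the 1 bounds the integral of r. They
  transfer finiteness in opposite directions: for the negative part from ln g to ln f, for the
  positive part from ln f to ln g.\<close>

lemma nn_integral_bounds:
  assumes "AE x in P. 0 < g x"
  shows "(\<integral>\<^sup>+x. ennreal (- ln (f x)) \<partial>P) \<le> (\<integral>\<^sup>+x. ennreal (- ln (g x)) \<partial>P) + 1"
    and "(\<integral>\<^sup>+x. ennreal (ln (g x)) \<partial>P) \<le> (\<integral>\<^sup>+x. ennreal (ln (f x)) \<partial>P) + 1"
proof -
  have *: "(\<integral>\<^sup>+x. ennreal (a x) \<partial>P) \<le> (\<integral>\<^sup>+x. ennreal (b x) \<partial>P) + 1"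
    if "AE x in P. a x \<le> b x + r x" "AE x in P. 0 \<le> r x" and [measurable]: "b \<in> borel_measurable P"
    for a b :: "'a \<Rightarrow> real"
  proof -
    have "(\<integral>\<^sup>+x. ennreal (a x) \<partial>P) \<le> (\<integral>\<^sup>+x. ennreal (b x) + ennreal (r x) \<partial>P)"
      using that(1,2)
      by (intro nn_integral_mono_AE, eventually_elim) (auto simp: ennreal_plus_if intro!: ennreal_leI)
    also have "\<dots> = (\<integral>\<^sup>+x. ennreal (b x) \<partial>P) + (\<integral>\<^sup>+x. ennreal (r x) \<partial>P)"
      by (intro nn_integral_add) measurable
    finally show ?thesis using nn_integral_r_le by (meson add_left_mono order.trans)
  qed
  show "(\<integral>\<^sup>+x. ennreal (- ln (f x)) \<partial>P) \<le> (\<integral>\<^sup>+x. ennreal (- ln (g x)) \<partial>P) + 1"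
    "(\<integral>\<^sup>+x. ennreal (ln (g x)) \<partial>P) \<le> (\<integral>\<^sup>+x. ennreal (ln (f x)) \<partial>P) + 1"
    using AE_ln_r[OF assms] by (auto intro!: * elim: eventually_mono)
qed

lemma eexpect_uminus_elog_integrable:
  assumes [measurable]: "h \<in> borel_measurable P" and "AE w in P. 0 < h w"
    and "(\<integral>\<^sup>+w. ennreal (- ln (h w)) \<partial>P) \<noteq> \<top>" "(\<integral>\<^sup>+w. ennreal (ln (h w)) \<partial>P) \<noteq> \<top>"
  shows "integrable P (\<lambda>w. ln (h w))" "eexpect P (\<lambda>w. - elog (h w)) = ereal (- (\<integral>w. ln (h w) \<partial>P))"
proof -
  show int: "integrable P (\<lambda>w. ln (h w))"
    using assms by (simp add: real_integrable_def)
  have e: "enn2ereal a = ereal (enn2real a)" if "a \<noteq> \<top>" for a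
    using that by (cases a) (auto simp: enn2ereal_ennreal)
  show "eexpect P (\<lambda>w. - elog (h w)) = ereal (- (\<integral>w. ln (h w) \<partial>P))"
    using assms unfolding eexpect_uminus_elog[OF assms(1,2)] real_lebesgue_integral_def[OF int]
    by (simp add: e)
qed

text \<open>A cross entropy below \<infinity> makes g positive almost everywhere and the negative
  part of ln g integrable, hence also that of ln f. The second hypothesis, on the entropy of f, then
  makes the positive part of ln f integrable, hence also that of ln g.\<close>

lemma integrable_ln:
  assumes less: "eexpect P (\<lambda>w. - elog (g w)) < \<infinity>" and greater: "eexpect P (\<lambda>w. - elog (f w)) > -\<infinity>"
  shows "AE w in P. 0 < g w"
    and "integrable P (\<lambda>w. ln (f w))" "eexpect P (\<lambda>w. - elog (f w)) = ereal (- (\<integral>w. ln (f w) \<partial>P))"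
    and "integrable P (\<lambda>w. ln (g w))" "eexpect P (\<lambda>w. - elog (g w)) = ereal (- (\<integral>w. ln (g w) \<partial>P))"
proof -
  show pos: "AE w in P. 0 < g w"
    by (rule eexpect_uminus_elog_less_top(1)[OF _ less]) measurable
  have g1: "(\<integral>\<^sup>+w. ennreal (- ln (g w)) \<partial>P) \<noteq> \<top>"
    by (rule eexpect_uminus_elog_less_top(2)[OF _ less]) measurable
  then have f1: "(\<integral>\<^sup>+w. ennreal (- ln (f w)) \<partial>P) \<noteq> \<top>"
    using nn_integral_bounds(1)[OF pos] by (auto simp: top_unique)
  have f2: "(\<integral>\<^sup>+w. ennreal (ln (f w)) \<partial>P) \<noteq> \<top>"
  proof
    assume "(\<integral>\<^sup>+w. ennreal (ln (f w)) \<partial>P) = \<top>"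
    moreover have "eexpect P (\<lambda>w. - elog (f w)) = enn2ereal (\<integral>\<^sup>+w. ennreal (- ln (f w)) \<partial>P) -
        enn2ereal (\<integral>\<^sup>+w. ennreal (ln (f w)) \<partial>P)"
      by (rule eexpect_uminus_elog[OF _ AE_f_pos]) measurable
    ultimately show False
      using greater f1 by (cases "\<integral>\<^sup>+w. ennreal (- ln (f w)) \<partial>P") (auto simp: enn2ereal_ennreal)
  qed
  then have g2: "(\<integral>\<^sup>+w. ennreal (ln (g w)) \<partial>P) \<noteq> \<top>"
    using nn_integral_bounds(2)[OF pos] by (auto simp: top_unique)
  have m: "f \<in> borel_measurable P" "g \<in> borel_measurable P" by measurable
  show "integrable P (\<lambda>w. ln (f w))" "eexpect P (\<lambda>w. - elog (f w)) = ereal (- (\<integral>w. ln (f w) \<partial>P))"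
    "integrable P (\<lambda>w. ln (g w))" "eexpect P (\<lambda>w. - elog (g w)) = ereal (- (\<integral>w. ln (g w) \<partial>P))"
    using eexpect_uminus_elog_integrable[OF m(1) AE_f_pos f1 f2]
      eexpect_uminus_elog_integrable[OF m(2) pos g1 g2] by simp_all
qed

text \<open>The integrand is almost everywhere the nonnegative slack in ln r \<le> r - 1 once g is
  positive almost everywhere. Its integral bounds the gap between the two cross entropies from
  below: nonnegativity gives Gibbs' inequality, and a zero gap forces zero slack.\<close>

lemma integral_ln_diff:
  assumes "integrable P (\<lambda>w. ln (f w))" "integrable P (\<lambda>w. ln (g w))"
  shows "(\<integral>w. r w - 1 - (ln (g w) - ln (f w)) \<partial>P) \<le> (\<integral>w. ln (f w) \<partial>P) - (\<integral>w. ln (g w) \<partial>P)"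
  using assms integrable_r integral_r_le P.prob_space by simp

lemma gibbs: "eexpect P (\<lambda>w. - elog (f w)) \<le> eexpect P (\<lambda>w. - elog (g w))"
\<comment> \<open>Outside this case the right-hand side is \<infinity> or the left-hand side is
  -\<infinity>, and the inequality is trivial.\<close>
proof (cases "eexpect P (\<lambda>w. - elog (g w)) < \<infinity> \<and> eexpect P (\<lambda>w. - elog (f w)) > -\<infinity>")
  case True
  note int = integrable_ln[OF True[THEN conjunct1] True[THEN conjunct2]]
  have "0 \<le> (\<integral>w. r w - 1 - (ln (g w) - ln (f w)) \<partial>P)"
    using AE_ln_r[OF int(1)] by (intro integral_nonneg_AE) (auto elim: eventually_mono)
  then show ?thesis
    using integral_ln_diff[OF int(2,4)] int(3,5) by simp
qed auto

text \<open>A zero gap makes the slack r - 1 - ln r vanish almost everywhere. Since ln x = x - 1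
  only at x = 1, this gives f = g almost everywhere under P, and the equal masses extend it to
  equality of the two laws.\<close>

lemma gibbs_eq:
  assumes eq: "eexpect P (\<lambda>w. - elog (g w)) = eexpect P (\<lambda>w. - elog (f w))"
    and fin: "\<bar>eexpect P (\<lambda>w. - elog (g w))\<bar> \<noteq> \<infinity>"
  shows "density M (\<lambda>x. ennreal (g x)) = P"
proof -
  have "eexpect P (\<lambda>w. - elog (g w)) < \<infinity>" "eexpect P (\<lambda>w. - elog (f w)) > -\<infinity>"
    using eq fin by auto
  note int = integrable_ln[OF this]
  let ?d = "\<lambda>w. r w - 1 - (ln (g w) - ln (f w))"
  have nn: "AE w in P. 0 \<le> ?d w"
    using AE_ln_r[OF int(1)] by (auto elim: eventually_mono)
  have i: "integrable P ?d"
    using int integrable_r by simp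
  have "(\<integral>w. ?d w \<partial>P) \<le> 0"
    using integral_ln_diff[OF int(2,4)] int(3,5) eq by simp
  then have "(\<integral>w. ?d w \<partial>P) = 0"
    using integral_nonneg_AE[OF nn] by simp
  then have "AE w in P. ?d w = 0"
    using integral_nonneg_eq_0_iff_AE[OF i nn] by simp
  then have "AE w in P. f w = g w"
    using AE_ln_r[OF int(1)] AE_f_pos
  proof eventually_elim
    case (elim w)
    then have "r w = 1" by (intro ln_eq_minus_one) auto
    then show ?case using elim by (simp add: r_def)
  qed
  then show ?thesis
    unfolding P_def using f_nonneg g_nonneg f_1 g_1 by (intro density_eq_of_AE_eq) auto
qed

end


section \<open>Joint laws with a conditional density, and disintegration\<close>

lemma prob_algebraD:
  "p \<in> space (prob_algebra X) \<Longrightarrow> prob_space p \<and> sets p = sets X \<and> space p = space X"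
  by (auto simp: space_prob_algebra dest: sets_eq_imp_space_eq)

lemma cond_densities_D:
  assumes "f \<in> cond_densities A B"
  shows "(\<lambda>(a, b). f a b) \<in> borel_measurable (A \<Otimes>\<^sub>M B)"
    and "\<And>a b. a \<in> space A \<Longrightarrow> b \<in> space B \<Longrightarrow> 0 \<le> f a b"
    and "\<And>a. a \<in> space A \<Longrightarrow> (\<integral>\<^sup>+b. ennreal (f a b) \<partial>B) = 1"
  using assms by (auto simp: cond_densities_def)

lemma sets_joint_density [simp]: "sets (joint_density A B f) = sets (A \<Otimes>\<^sub>M B)"
  by (simp add: joint_density_def)

text \<open>Links the joint law p(x) p_i(z|x) with the iterated expectation over x and then I(x)
  that occurs in \<open>L_xz\<close>.\<close>

lemma nn_integral_joint_density:
  assumes p: "p \<in> space (prob_algebra A)" and "sigma_finite_measure B" and f: "f \<in> cond_densities A B"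
    and h [measurable]: "h \<in> borel_measurable (A \<Otimes>\<^sub>M B)"
  shows "(\<integral>\<^sup>+w. h w \<partial>joint_density p B f) = (\<integral>\<^sup>+a. \<integral>\<^sup>+b. h (a, b) \<partial>density B (\<lambda>b. ennreal (f a b)) \<partial>p)"
proof -
  interpret B: sigma_finite_measure B by fact
  have sp: "space p = space A" and [measurable_cong]: "sets p = sets A"
    using prob_algebraD[OF p] by auto
  have [measurable]: "(\<lambda>(a, b). f a b) \<in> borel_measurable (p \<Otimes>\<^sub>M B)"
    using cond_densities_D(1)[OF f] by (simp cong: measurable_cong_sets sets_pair_measure_cong)
  have "(\<integral>\<^sup>+w. h w \<partial>joint_density p B f) = (\<integral>\<^sup>+w. (case w of (a, b) \<Rightarrow> ennreal (f a b)) * h w \<partial>(p \<Otimes>\<^sub>M B))"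
    unfolding joint_density_def by (intro nn_integral_density) measurable
  also have "\<dots> = (\<integral>\<^sup>+a. \<integral>\<^sup>+b. ennreal (f a b) * h (a, b) \<partial>B \<partial>p)"
    by (subst B.nn_integral_fst[symmetric]) (auto simp: split_beta')
  also have "\<dots> = (\<integral>\<^sup>+a. \<integral>\<^sup>+b. h (a, b) \<partial>density B (\<lambda>b. ennreal (f a b)) \<partial>p)"
    by (intro nn_integral_cong nn_integral_density[symmetric]) (measurable, auto simp: sp)
  finally show ?thesis .
qed

lemma joint_density_in_prob_algebra:
  assumes p: "p \<in> space (prob_algebra A)" and "sigma_finite_measure B" and f: "f \<in> cond_densities A B"
  shows "joint_density p B f \<in> space (prob_algebra (A \<Otimes>\<^sub>M B))"
proof -
  have p': "prob_space p" "space p = space A" "sets p = sets A" using prob_algebraD[OF p] by auto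
  have "emeasure (joint_density p B f) (space (joint_density p B f)) = (\<integral>\<^sup>+w. 1 \<partial>joint_density p B f)"
    by simp
  also have "\<dots> = (\<integral>\<^sup>+a. \<integral>\<^sup>+b. 1 \<partial>density B (\<lambda>b. ennreal (f a b)) \<partial>p)"
    by (rule nn_integral_joint_density[OF assms]) simp
  also have "\<dots> = (\<integral>\<^sup>+a. 1 \<partial>p)"
  proof (intro nn_integral_cong)
    fix a assume "a \<in> space p"
    then have [measurable]: "f a \<in> borel_measurable B" and 1: "(\<integral>\<^sup>+b. ennreal (f a b) \<partial>B) = 1"
      using cond_densities_D[OF f] p' measurable_compose_Pair1 by force+
    show "(\<integral>\<^sup>+b. 1 \<partial>density B (\<lambda>b. ennreal (f a b))) = 1"
      using 1 by (subst nn_integral_density) auto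
  qed
  also have "\<dots> = 1" using prob_space.emeasure_space_1[OF p'(1)] by simp
  finally show ?thesis
    using p' by (auto simp: space_prob_algebra intro!: prob_spaceI sets_pair_measure_cong)
qed

text \<open>A Radon-Nikodym derivative of J has rows of mass m(a), and the marginal condition says
  that m is a density of p with respect to itself, so m = 1 almost everywhere. The lemma is applied
  twice: to the product law, giving an \<open>I\<close> for the witness in \<open>L_xz\<close>, and
  to p(x,y), giving the posterior that minimizes \<open>R_y\<close>.\<close>

lemma exists_cond_density:
  assumes p: "p \<in> space (prob_algebra A)" and "sigma_finite_measure B"
    and J: "J \<in> space (prob_algebra (A \<Otimes>\<^sub>M B))" and marginal: "distr J A fst = p"
    and ac: "absolutely_continuous (p \<Otimes>\<^sub>M B) J"
  shows "\<exists>f\<in>cond_densities A B. joint_density p B f = J"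
proof -
  interpret B: sigma_finite_measure B by fact
  interpret p: prob_space p using prob_algebraD[OF p] by simp
  interpret J: prob_space J using prob_algebraD[OF J] by simp
  interpret pB: pair_sigma_finite p B ..
  have sp: "space p = space A" and sets_p [measurable_cong]: "sets p = sets A"
    using prob_algebraD[OF p] by auto
  have sets_J: "sets J = sets (p \<Otimes>\<^sub>M B)"
    using prob_algebraD[OF J] sets_p by (metis sets_pair_measure_cong)
  \<comment> \<open>A real-valued version of the derivative is taken, because
    \<open>cond_densities\<close> consists of real functions.\<close>
  obtain d where [measurable]: "d \<in> borel_measurable (p \<Otimes>\<^sub>M B)"
    and RN: "AE w in p \<Otimes>\<^sub>M B. RN_deriv (p \<Otimes>\<^sub>M B) J w = ennreal (d w)" and d_nonneg: "\<And>w. 0 \<le> d w"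
    using pB.real_RN_deriv[OF J.finite_measure_axioms ac sets_J] by metis
  have "J = density (p \<Otimes>\<^sub>M B) (RN_deriv (p \<Otimes>\<^sub>M B) J)"
    by (rule pB.density_RN_deriv[OF ac sets_J, symmetric])
  also have "\<dots> = density (p \<Otimes>\<^sub>M B) (\<lambda>w. ennreal (d w))"
    using RN by (intro density_cong) auto
  finally have J_eq: "J = density (p \<Otimes>\<^sub>M B) (\<lambda>w. ennreal (d w))" .
  define m where "m a = (\<integral>\<^sup>+b. ennreal (d (a, b)) \<partial>B)" for a
  have m [measurable]: "m \<in> borel_measurable p"
    unfolding m_def by measurable
  have "density p m = density p (\<lambda>_. 1)"
  proof (rule measure_eqI)
    fix S assume "S \<in> sets (density p m)"
    then have [measurable]: "S \<in> sets p" "S \<in> sets A" by (simp_all add: sets_p)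
    have "emeasure p S = (\<integral>\<^sup>+w. indicator S (fst w) \<partial>J)"
      unfolding marginal[symmetric]
      by (subst nn_integral_indicator[symmetric], simp, subst nn_integral_distr)
        (simp_all add: measurable_cong_sets[OF sets_J refl])
    also have "\<dots> = (\<integral>\<^sup>+w. ennreal (d w) * indicator S (fst w) \<partial>(p \<Otimes>\<^sub>M B))"
      by (subst J_eq, intro nn_integral_density) measurable
    also have "\<dots> = (\<integral>\<^sup>+a. \<integral>\<^sup>+b. ennreal (d (a, b)) * indicator S a \<partial>B \<partial>p)"
      by (subst B.nn_integral_fst[symmetric]) auto
    also have "\<dots> = (\<integral>\<^sup>+a. m a * indicator S a \<partial>p)"
      unfolding m_def by (intro nn_integral_cong nn_integral_multc) auto
    finally show "emeasure (density p m) S = emeasure (density p (\<lambda>_. 1)) S"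
      by (simp add: emeasure_density)
  qed simp
  then have m_1: "AE a in p. m a = 1"
    by (intro p.density_unique) auto
  then have "AE a in p. a \<in> space p \<and> m a = 1"
    using AE_space by eventually_elim simp
  then obtain a0 where a0: "a0 \<in> space p" "m a0 = 1"
    using eventually_happens'[OF p.ae_filter_bot] by blast
  \<comment> \<open>Members of \<open>cond_densities\<close> must be normalized at every point, not
    just almost everywhere. The exceptional rows are overwritten by one good row \<open>a0\<close>,
    which exists because a probability measure has no full null set.\<close>
  define f where "f a b = (if m a = 1 then d (a, b) else d (a0, b))" for a b
  have "f \<in> cond_densities A B"
  proof -
    have [measurable]: "(\<lambda>b. d (a0, b)) \<in> borel_measurable B"
      using a0 by measurable
    have "(\<lambda>(a, b). f a b) \<in> borel_measurable (p \<Otimes>\<^sub>M B)"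
      unfolding f_def split_beta' by measurable
    then have "(\<lambda>(a, b). f a b) \<in> borel_measurable (A \<Otimes>\<^sub>M B)"
      by (simp cong: measurable_cong_sets sets_pair_measure_cong)
    moreover have "(\<integral>\<^sup>+b. ennreal (f a b) \<partial>B) = 1" for a
      using a0 by (cases "m a = 1") (auto simp: f_def m_def)
    ultimately show ?thesis
      using d_nonneg by (simp add: cond_densities_def) (simp add: f_def)
  qed
  moreover have "joint_density p B f = J"
  proof -
    have [measurable]: "(\<lambda>(a, b). f a b) \<in> borel_measurable (p \<Otimes>\<^sub>M B)"
      using cond_densities_D(1)[OF \<open>f \<in> _\<close>] by (simp cong: measurable_cong_sets sets_pair_measure_cong)
    have "AE w in p \<Otimes>\<^sub>M B. m (fst w) = 1"
      using m_1 by (intro pB.AE_pair_measure) auto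
    then have "AE w in p \<Otimes>\<^sub>M B. (case w of (a, b) \<Rightarrow> ennreal (f a b)) = ennreal (d w)"
      by eventually_elim (auto simp: f_def)
    then show ?thesis
      unfolding joint_density_def J_eq by (intro density_cong) auto
  qed
  ultimately show ?thesis by blast
qed

lemma two_densities_cond:
  assumes p: "p \<in> space (prob_algebra A)" and B: "sigma_finite_measure B"
    and f: "f \<in> cond_densities A B" and g: "g \<in> cond_densities A B"
  shows "two_densities (p \<Otimes>\<^sub>M B) (\<lambda>(a, b). f a b) (\<lambda>(a, b). g a b)"
proof -
  have p': "space p = space A" "sets p = sets A" using prob_algebraD[OF p] by auto
  have *: "(\<lambda>(a, b). h a b) \<in> borel_measurable (p \<Otimes>\<^sub>M B)"
    "\<And>w. w \<in> space (p \<Otimes>\<^sub>M B) \<Longrightarrow> 0 \<le> (case w of (a, b) \<Rightarrow> h a b)"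
    "(\<integral>\<^sup>+w. ennreal (case w of (a, b) \<Rightarrow> h a b) \<partial>(p \<Otimes>\<^sub>M B)) = 1"
    if h: "h \<in> cond_densities A B" for h
  proof -
    show m: "(\<lambda>(a, b). h a b) \<in> borel_measurable (p \<Otimes>\<^sub>M B)"
      using cond_densities_D(1)[OF h] p' by (simp cong: measurable_cong_sets sets_pair_measure_cong)
    show "\<And>w. w \<in> space (p \<Otimes>\<^sub>M B) \<Longrightarrow> 0 \<le> (case w of (a, b) \<Rightarrow> h a b)"
      using cond_densities_D(2)[OF h] p' by (auto simp: space_pair_measure)
    have "prob_space (joint_density p B h)"
      using prob_algebraD[OF joint_density_in_prob_algebra[OF p B h]] by simp
    then have "emeasure (joint_density p B h) (space (p \<Otimes>\<^sub>M B)) = 1"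
      using prob_space.emeasure_space_1 by (fastforce simp: joint_density_def)
    then show "(\<integral>\<^sup>+w. ennreal (case w of (a, b) \<Rightarrow> h a b) \<partial>(p \<Otimes>\<^sub>M B)) = 1"
      using m unfolding joint_density_def
      by (subst (asm) emeasure_density) (auto simp: split_beta' cong: nn_integral_cong_simp)
  qed
  show ?thesis
    by (intro two_densities.intro *[OF f] *[OF g])
qed

text \<open>Here the reference law is the joint law of f itself. Equality can identify g only up to
  its joint law, since changes on a null set do not affect the cross entropy.\<close>

lemma
  assumes p: "p \<in> space (prob_algebra A)" and B: "sigma_finite_measure B"
    and f: "f \<in> cond_densities A B" and g: "g \<in> cond_densities A B"
  defines "P \<equiv> joint_density p B f"
  shows gibbs_cond: "eexpect P (\<lambda>(a, b). - elog (f a b)) \<le> eexpect P (\<lambda>(a, b). - elog (g a b))"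
    and gibbs_cond_eq: "eexpect P (\<lambda>(a, b). - elog (g a b)) = eexpect P (\<lambda>(a, b). - elog (f a b)) \<Longrightarrow>
      \<bar>eexpect P (\<lambda>(a, b). - elog (g a b))\<bar> \<noteq> \<infinity> \<Longrightarrow> joint_density p B g = P"
proof -
  interpret two_densities "p \<Otimes>\<^sub>M B" "\<lambda>(a, b). f a b" "\<lambda>(a, b). g a b"
    by (rule two_densities_cond[OF p B f g])
  have P: "two_densities.P (p \<Otimes>\<^sub>M B) (\<lambda>(a, b). f a b) = joint_density p B f"
    unfolding P_def joint_density_def by (simp add: split_beta')
  show "eexpect P (\<lambda>(a, b). - elog (f a b)) \<le> eexpect P (\<lambda>(a, b). - elog (g a b))"
    using gibbs unfolding P \<open>P \<equiv> joint_density p B f\<close> by (simp add: split_beta')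
  show "joint_density p B g = P"
    if "eexpect P (\<lambda>(a, b). - elog (g a b)) = eexpect P (\<lambda>(a, b). - elog (f a b))"
      "\<bar>eexpect P (\<lambda>(a, b). - elog (g a b))\<bar> \<noteq> \<infinity>"
    using gibbs_eq that unfolding P \<open>P \<equiv> joint_density p B f\<close>
    by (simp add: split_beta' joint_density_def)
qed

section \<open>Laws induced by a generator\<close>

lemma gen_xz_in_prob_algebra:
  assumes G [measurable]: "G \<in> measurable (Y \<Otimes>\<^sub>M Z) (prob_algebra X)"
    and py: "py \<in> space (prob_algebra Y)" and pz: "pz \<in> space (prob_algebra Z)"
  shows "(\<lambda>z. distr (gen_x_given_z py G z) (X \<Otimes>\<^sub>M Z) (\<lambda>x. (x, z))) \<in> measurable Z (prob_algebra (X \<Otimes>\<^sub>M Z))"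
    and "gen_x_given_z py G \<in> measurable Z (prob_algebra X)"
    and "gen_xz X Z py pz G \<in> space (prob_algebra (X \<Otimes>\<^sub>M Z))"
proof -
  show [measurable]: "gen_x_given_z py G \<in> measurable Z (prob_algebra X)"
    unfolding gen_x_given_z_def
    by (rule measurable_bind_prob_space2[of "\<lambda>_. py" _ Y]) (use py in measurable)
  show *: "(\<lambda>z. distr (gen_x_given_z py G z) (X \<Otimes>\<^sub>M Z) (\<lambda>x. (x, z))) \<in> measurable Z (prob_algebra (X \<Otimes>\<^sub>M Z))"
    by measurable
  show "gen_xz X Z py pz G \<in> space (prob_algebra (X \<Otimes>\<^sub>M Z))"
    unfolding gen_xz_def using prob_space_bind'[OF pz *] sets_bind'[OF pz *]
    by (simp add: space_prob_algebra)
qed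

lemma nn_integral_gen_xz:
  assumes G [measurable]: "G \<in> measurable (Y \<Otimes>\<^sub>M Z) (prob_algebra X)"
    and py: "py \<in> space (prob_algebra Y)" and pz: "pz \<in> space (prob_algebra Z)"
    and h [measurable]: "h \<in> borel_measurable (X \<Otimes>\<^sub>M Z)"
  shows "(\<integral>\<^sup>+w. h w \<partial>gen_xz X Z py pz G) = (\<integral>\<^sup>+z. \<integral>\<^sup>+y. \<integral>\<^sup>+x. h (x, z) \<partial>G (y, z) \<partial>py \<partial>pz)"
proof -
  note kernel = gen_xz_in_prob_algebra[OF G py pz]
  have pz': "sets pz = sets Z" "space pz = space Z" and py': "sets py = sets Y" 
    using prob_algebraD[OF pz] prob_algebraD[OF py] by auto
  have "(\<integral>\<^sup>+w. h w \<partial>gen_xz X Z py pz G) =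
      (\<integral>\<^sup>+z. \<integral>\<^sup>+w. h w \<partial>distr (gen_x_given_z py G z) (X \<Otimes>\<^sub>M Z) (\<lambda>x. (x, z)) \<partial>pz)"
    unfolding gen_xz_def
    by (rule nn_integral_bind[OF h])
      (use measurable_prob_algebraD[OF kernel(1)] pz' in \<open>simp cong: measurable_cong_sets\<close>)
  also have "\<dots> = (\<integral>\<^sup>+z. \<integral>\<^sup>+y. \<integral>\<^sup>+x. h (x, z) \<partial>G (y, z) \<partial>py \<partial>pz)"
  proof (intro nn_integral_cong)
    fix z assume "z \<in> space pz"
    then have z [measurable]: "z \<in> space Z" using pz' by simp
    have "sets (gen_x_given_z py G z) = sets X"
      using prob_algebraD[OF measurable_space[OF kernel(2) z]] by simp
    then have "(\<integral>\<^sup>+w. h w \<partial>distr (gen_x_given_z py G z) (X \<Otimes>\<^sub>M Z) (\<lambda>x. (x, z))) =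
        (\<integral>\<^sup>+x. h (x, z) \<partial>gen_x_given_z py G z)"
      by (intro nn_integral_distr) (auto cong: measurable_cong_sets)
    also have "\<dots> = (\<integral>\<^sup>+y. \<integral>\<^sup>+x. h (x, z) \<partial>G (y, z) \<partial>py)"
      unfolding gen_x_given_z_def
    proof (rule nn_integral_bind[of _ X])
      have "(\<lambda>y. G (y, z)) \<in> measurable Y (prob_algebra X)" by measurable
      from measurable_prob_algebraD[OF this]
      show "(\<lambda>y. G (y, z)) \<in> measurable py (subprob_algebra X)"
        using py' by (simp cong: measurable_cong_sets)
    qed measurable
    finally show "(\<integral>\<^sup>+w. h w \<partial>distr (gen_x_given_z py G z) (X \<Otimes>\<^sub>M Z) (\<lambda>x. (x, z))) =
        (\<integral>\<^sup>+y. \<integral>\<^sup>+x. h (x, z) \<partial>G (y, z) \<partial>py)" .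
  qed
  finally show ?thesis .
qed

text \<open>The two constructions differ only by exchanging the latent variables, so facts about
  \<open>gen_xz\<close> carry over to \<open>gen_xy\<close>.\<close>

lemma gen_xy_conv_gen_xz: "gen_xy X Y py pz G = gen_xz X Y pz py (\<lambda>(z, y). G (y, z))"
  by (simp add: gen_xy_def gen_xz_def gen_x_given_y_def gen_x_given_z_def)

lemma generators_swap:
  "G \<in> generators X Y Z \<Longrightarrow> (\<lambda>(z, y). G (y, z)) \<in> measurable (Z \<Otimes>\<^sub>M Y) (prob_algebra X)"
  unfolding generators_def split_beta'
  by (auto intro: measurable_compose[of "\<lambda>w. (snd w, fst w)" _ "Y \<Otimes>\<^sub>M Z"])

lemma gen_xy_in_prob_algebra:
  assumes G: "G \<in> generators X Y Z"
    and py: "py \<in> space (prob_algebra Y)" and pz: "pz \<in> space (prob_algebra Z)"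
  shows "gen_xy X Y py pz G \<in> space (prob_algebra (X \<Otimes>\<^sub>M Y))"
  unfolding gen_xy_conv_gen_xz by (rule gen_xz_in_prob_algebra[OF generators_swap[OF G] pz py])

lemma nn_integral_gen_xy:
  assumes G: "G \<in> generators X Y Z"
    and py: "py \<in> space (prob_algebra Y)" and pz: "pz \<in> space (prob_algebra Z)"
    and h: "h \<in> borel_measurable (X \<Otimes>\<^sub>M Y)"
  shows "(\<integral>\<^sup>+w. h w \<partial>gen_xy X Y py pz G) = (\<integral>\<^sup>+y. \<integral>\<^sup>+z. \<integral>\<^sup>+x. h (x, y) \<partial>G (y, z) \<partial>pz \<partial>py)"
  unfolding gen_xy_conv_gen_xz nn_integral_gen_xz[OF generators_swap[OF G] pz py h] by simp

text \<open>The map k selects the latent variable that the critic sees: \<open>snd\<close> for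
  \<open>L_xz\<close> and \<open>fst\<close> for \<open>L_xy\<close>. The measurability claim allows
  the outer product integral to be iterated afterwards.\<close>

lemma eexpect_generator:
  assumes G: "G \<in> generators X Y Z"
    and py: "py \<in> space (prob_algebra Y)" and pz: "pz \<in> space (prob_algebra Z)"
    and k: "k \<in> measurable (Y \<Otimes>\<^sub>M Z) W"
    and D: "D \<in> critics (X \<Otimes>\<^sub>M W)"
  shows "eexpect (py \<Otimes>\<^sub>M pz) (\<lambda>(y, z). eexpect (G (y, z)) (\<lambda>x. elog (1 - D (x, k (y, z))))) =
      - enn2ereal (\<integral>\<^sup>+w. \<integral>\<^sup>+x. log_loss (1 - D (x, k w)) \<partial>G w \<partial>(py \<Otimes>\<^sub>M pz))"
    and "(\<lambda>w. \<integral>\<^sup>+x. log_loss (1 - D (x, k w)) \<partial>G w) \<in> borel_measurable (py \<Otimes>\<^sub>M pz)"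
proof -
  have [measurable]: "D \<in> borel_measurable (X \<Otimes>\<^sub>M W)" and D1: "\<And>w. w \<in> space (X \<Otimes>\<^sub>M W) \<Longrightarrow> 0 \<le> D w"
    using D by (auto simp: critics_def)
  have sp: "space (py \<Otimes>\<^sub>M pz) = space (Y \<Otimes>\<^sub>M Z)" and sets: "sets (py \<Otimes>\<^sub>M pz) = sets (Y \<Otimes>\<^sub>M Z)"
    using prob_algebraD[OF py] prob_algebraD[OF pz] by (auto simp: space_pair_measure intro: sets_pair_measure_cong)
  have G': "G \<in> measurable (Y \<Otimes>\<^sub>M Z) (subprob_algebra X)" and Gp: "G \<in> measurable (Y \<Otimes>\<^sub>M Z) (prob_algebra X)"
    using G measurable_prob_algebraD by (auto simp: generators_def)
  note k [measurable]
  have "(\<lambda>w. \<integral>\<^sup>+x. log_loss (1 - D (x, k w)) \<partial>G w) \<in> borel_measurable (Y \<Otimes>\<^sub>M Z)"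
    by (rule nn_integral_measurable_subprob_algebra2[OF _ G']) measurable
  then show "(\<lambda>w. \<integral>\<^sup>+x. log_loss (1 - D (x, k w)) \<partial>G w) \<in> borel_measurable (py \<Otimes>\<^sub>M pz)"
    by (simp cong: measurable_cong_sets add: sets)
  have "eexpect (py \<Otimes>\<^sub>M pz) (\<lambda>(y, z). eexpect (G (y, z)) (\<lambda>x. elog (1 - D (x, k (y, z))))) =
    eexpect (py \<Otimes>\<^sub>M pz) (\<lambda>w. - enn2ereal (\<integral>\<^sup>+x. log_loss (1 - D (x, k w)) \<partial>G w))"
  proof (intro eexpect_cong)
    fix w assume w: "w \<in> space (py \<Otimes>\<^sub>M pz)"
    then have "space (G w) = space X" "k w \<in> space W"
      using prob_algebraD[OF measurable_space[OF Gp]] measurable_space[OF k] by (auto simp: sp)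
    then show "(case w of (y, z) \<Rightarrow> eexpect (G (y, z)) (\<lambda>x. elog (1 - D (x, k (y, z))))) =
        - enn2ereal (\<integral>\<^sup>+x. log_loss (1 - D (x, k w)) \<partial>G w)"
      using D1 by (auto simp: space_pair_measure split_beta' intro!: eexpect_elog)
  qed
  then show "eexpect (py \<Otimes>\<^sub>M pz) (\<lambda>(y, z). eexpect (G (y, z)) (\<lambda>x. elog (1 - D (x, k (y, z))))) =
      - enn2ereal (\<integral>\<^sup>+w. \<integral>\<^sup>+x. log_loss (1 - D (x, k w)) \<partial>G w \<partial>(py \<Otimes>\<^sub>M pz))"
    by (simp add: eexpect_uminus_enn2ereal)
qed


section \<open>The two games as losses of joint laws\<close>

lemma L_xz_eq:
  assumes px: "px \<in> space (prob_algebra X)" and py: "py \<in> space (prob_algebra Y)"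
    and pz: "pz \<in> space (prob_algebra Z)" and Z: "sigma_finite_measure Z"
    and I: "I \<in> cond_densities X Z" and G: "G \<in> generators X Y Z" and D: "D \<in> critics (X \<Otimes>\<^sub>M Z)"
  shows "L_xz Z px py pz I G D =
    - enn2ereal (gan_loss (joint_density px Z I) (gen_xz X Z py pz G) D)"
proof -
  have D_meas [measurable]: "D \<in> borel_measurable (X \<Otimes>\<^sub>M Z)"
    and D_le: "\<And>w. w \<in> space (X \<Otimes>\<^sub>M Z) \<Longrightarrow> D w \<le> 1"
    using D by (auto simp: critics_def)
  have sp: "space px = space X" using prob_algebraD[OF px] by simp
  interpret py: prob_space py using prob_algebraD[OF py] by simp
  interpret pz: prob_space pz using prob_algebraD[OF pz] by simp
  interpret pair_sigma_finite py pz ..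
  have "eexpect px (\<lambda>x. eexpect (density Z (\<lambda>z. ennreal (I x z))) (\<lambda>z. elog (D (x, z)))) =
    eexpect px (\<lambda>x. - enn2ereal (\<integral>\<^sup>+z. log_loss (D (x, z)) \<partial>density Z (\<lambda>z. ennreal (I x z))))"
    using D_le by (intro eexpect_cong eexpect_elog) (auto simp: sp space_pair_measure)
  also have "\<dots> = - enn2ereal (\<integral>\<^sup>+w. log_loss (D w) \<partial>joint_density px Z I)"
    by (subst nn_integral_joint_density[OF px Z I]) (simp_all add: eexpect_uminus_enn2ereal)
  finally have data: "eexpect px (\<lambda>x. eexpect (density Z (\<lambda>z. ennreal (I x z))) (\<lambda>z. elog (D (x, z)))) =
    - enn2ereal (\<integral>\<^sup>+w. log_loss (D w) \<partial>joint_density px Z I)" .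
  have snd: "snd \<in> measurable (Y \<Otimes>\<^sub>M Z) Z" by simp
  note gen = eexpect_generator[OF G py pz snd D]
  have "(\<integral>\<^sup>+w. \<integral>\<^sup>+x. log_loss (1 - D (x, snd w)) \<partial>G w \<partial>(py \<Otimes>\<^sub>M pz)) =
    (\<integral>\<^sup>+w. log_loss (1 - D w) \<partial>gen_xz X Z py pz G)"
    \<comment> \<open>Tonelli with z outermost, matching the order of integration in
      \<open>gen_xz\<close>.\<close>
    using nn_integral_snd[OF gen(2)] nn_integral_gen_xz[OF G[unfolded generators_def] py pz, of "\<lambda>w. log_loss (1 - D w)"]
    by simp
  then show ?thesis
    using gen(1) by (simp add: L_xz_def data gan_loss_def uminus_enn2ereal_add)
qed

lemma L_xy_eq:
  assumes py: "py \<in> space (prob_algebra Y)" and pz: "pz \<in> space (prob_algebra Z)"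
    and pxy: "pxy \<in> space (prob_algebra (X \<Otimes>\<^sub>M Y))"
    and G: "G \<in> generators X Y Z" and D: "D \<in> critics (X \<Otimes>\<^sub>M Y)"
  shows "L_xy pxy py pz G D = - enn2ereal (gan_loss pxy (gen_xy X Y py pz G) D)"
proof -
  have D_meas [measurable]: "D \<in> borel_measurable (X \<Otimes>\<^sub>M Y)"
    and D_le: "\<And>w. w \<in> space (X \<Otimes>\<^sub>M Y) \<Longrightarrow> D w \<le> 1"
    using D by (auto simp: critics_def)
  interpret py: prob_space py using prob_algebraD[OF py] by simp
  interpret pz: prob_space pz using prob_algebraD[OF pz] by simp
  have data: "eexpect pxy (\<lambda>(x, y). elog (D (x, y))) = - enn2ereal (\<integral>\<^sup>+w. log_loss (D w) \<partial>pxy)"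
    using D_le prob_algebraD[OF pxy] eexpect_elog[of pxy D] by (simp add: split_beta')
  have fst: "fst \<in> measurable (Y \<Otimes>\<^sub>M Z) Y" by simp
  note gen = eexpect_generator[OF G py pz fst D]
  have "(\<integral>\<^sup>+w. \<integral>\<^sup>+x. log_loss (1 - D (x, fst w)) \<partial>G w \<partial>(py \<Otimes>\<^sub>M pz)) =
    (\<integral>\<^sup>+w. log_loss (1 - D w) \<partial>gen_xy X Y py pz G)"
    using pz.nn_integral_fst[OF gen(2)] nn_integral_gen_xy[OF G py pz, of "\<lambda>w. log_loss (1 - D w)"]
    by simp
  then show ?thesis
    using gen(1) by (simp add: L_xy_def data gan_loss_def uminus_enn2ereal_add)
qed

lemma gen_xz_const:
  assumes px: "px \<in> space (prob_algebra X)" and py: "py \<in> space (prob_algebra Y)"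
    and pz: "pz \<in> space (prob_algebra Z)"
  shows "gen_xz X Z py pz (\<lambda>_. px) = px \<Otimes>\<^sub>M pz"
proof (rule measure_eqI)
  interpret px: prob_space px using prob_algebraD[OF px] by simp
  interpret py: prob_space py using prob_algebraD[OF py] by simp
  interpret pz: prob_space pz using prob_algebraD[OF pz] by simp
  interpret pair_sigma_finite px pz ..
  have G: "(\<lambda>_. px) \<in> measurable (Y \<Otimes>\<^sub>M Z) (prob_algebra X)" using px by simp
  have sets: "sets (px \<Otimes>\<^sub>M pz) = sets (X \<Otimes>\<^sub>M Z)"
    using prob_algebraD[OF px] prob_algebraD[OF pz] by (intro sets_pair_measure_cong) auto
  show sets': "sets (gen_xz X Z py pz (\<lambda>_. px)) = sets (px \<Otimes>\<^sub>M pz)"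
    using gen_xz_in_prob_algebra(3)[OF G py pz] sets by (simp add: space_prob_algebra)
  fix A assume "A \<in> sets (gen_xz X Z py pz (\<lambda>_. px))"
  then have A [measurable]: "A \<in> sets (px \<Otimes>\<^sub>M pz)" "A \<in> sets (X \<Otimes>\<^sub>M Z)" using sets sets' by auto
  have "emeasure (gen_xz X Z py pz (\<lambda>_. px)) A = (\<integral>\<^sup>+z. \<integral>\<^sup>+y. \<integral>\<^sup>+x. indicator A (x, z) \<partial>px \<partial>py \<partial>pz)"
    using \<open>A \<in> sets (gen_xz _ _ _ _ _)\<close> nn_integral_gen_xz[OF G py pz, of "indicator A"] by simp
  also have "\<dots> = (\<integral>\<^sup>+z. \<integral>\<^sup>+x. indicator A (x, z) \<partial>px \<partial>pz)"
    by (simp add: py.emeasure_space_1)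
  also have "\<dots> = emeasure (px \<Otimes>\<^sub>M pz) A"
    by (subst nn_integral_snd) auto
  finally show "emeasure (gen_xz X Z py pz (\<lambda>_. px)) A = emeasure (px \<Otimes>\<^sub>M pz) A" .
qed

text \<open>A measurable set is null for a product exactly when almost all its sections are null,
  and null sections pass from N to N'.\<close>

lemma absolutely_continuous_pair_measure:
  assumes "sigma_finite_measure N" "sigma_finite_measure N'" and sets: "sets N' = sets N"
    and ac: "absolutely_continuous N N'"
  shows "absolutely_continuous (M \<Otimes>\<^sub>M N) (M \<Otimes>\<^sub>M N')"
proof -
  interpret N: sigma_finite_measure N by fact
  interpret N': sigma_finite_measure N' by fact
  have sets_pair: "sets (M \<Otimes>\<^sub>M N') = sets (M \<Otimes>\<^sub>M N)"
    using sets by (intro sets_pair_measure_cong) auto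
  have "S \<in> null_sets (M \<Otimes>\<^sub>M N')" if "S \<in> null_sets (M \<Otimes>\<^sub>M N)" for S
  proof -
    have S [measurable]: "S \<in> sets (M \<Otimes>\<^sub>M N)" "S \<in> sets (M \<Otimes>\<^sub>M N')"
      using that sets_pair by auto
    have "(\<integral>\<^sup>+x. emeasure N (Pair x -` S) \<partial>M) = 0"
      using that S by (simp add: N.emeasure_pair_measure_alt[symmetric] null_sets_def)
    then have "AE x in M. emeasure N (Pair x -` S) = 0"
      by (subst (asm) nn_integral_0_iff_AE) (auto intro: N.measurable_emeasure_Pair)
    then have "AE x in M. emeasure N' (Pair x -` S) = 0"
    proof eventually_elim
      case (elim x)
      then have "Pair x -` S \<in> null_sets N"
        using sets_Pair1[OF S(1)] by (auto simp: null_sets_def)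
      then show ?case
        using ac by (auto simp: absolutely_continuous_def)
    qed
    then have "(\<integral>\<^sup>+x. emeasure N' (Pair x -` S) \<partial>M) = 0"
      by (subst nn_integral_0_iff_AE) (auto intro: N'.measurable_emeasure_Pair)
    then show ?thesis
      using S by (simp add: N'.emeasure_pair_measure_alt null_sets_def)
  qed
  then show ?thesis by (auto simp: absolutely_continuous_def)
qed

lemma is_arg_max_cong:
  fixes f g :: "'a \<Rightarrow> 'b::order"
  shows "(\<And>x. S x \<Longrightarrow> f x = g x) \<Longrightarrow> is_arg_max f S x \<longleftrightarrow> is_arg_max g S x"
  by (auto simp: is_arg_max_def)

section \<open>Equilibria and minimizers of the reconstruction objectives\<close>

context sgan_setting
begin

lemma pxy_prob: "pxy \<in> space (prob_algebra (X \<Otimes>\<^sub>M Y))"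
  unfolding pxy using gen_xy_in_prob_algebra[OF _ py pz] T by (simp add: generators_def)

lemma px_prob: "px \<in> space (prob_algebra X)"
  unfolding px using prob_algebraD[OF pxy_prob]
  by (auto simp: space_prob_algebra cong: measurable_cong_sets intro!: prob_space.prob_space_distr)

text \<open>Supplies the optimal configuration of \<open>L_xz\<close>. Absolute continuity of p(z)
  enters here: it makes the product law absolutely continuous, so that some conditional density
  realizes it.\<close>

lemma independent_pair_attains:
  "\<exists>I\<in>cond_densities X Z. joint_density px Z I = gen_xz X Z py pz (\<lambda>_. px)"
  unfolding gen_xz_const[OF px_prob py pz]
proof (rule exists_cond_density[OF px_prob sigma_finite_Z])
  interpret px: prob_space px using prob_algebraD[OF px_prob] by simp
  interpret pz: prob_space pz using prob_algebraD[OF pz] by simp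
  interpret pair_prob_space px pz ..
  have sets: "sets px = sets X" "sets pz = sets Z" using prob_algebraD[OF px_prob] prob_algebraD[OF pz] by auto
  show "px \<Otimes>\<^sub>M pz \<in> space (prob_algebra (X \<Otimes>\<^sub>M Z))"
    using sets by (auto simp: space_prob_algebra prob_space_axioms intro!: sets_pair_measure_cong)
  have "distr (px \<Otimes>\<^sub>M pz) px fst = px" by (rule pz.distr_pair_fst)
  then show "distr (px \<Otimes>\<^sub>M pz) X fst = px"
    using sets by (metis distr_cong)
  show "absolutely_continuous (px \<Otimes>\<^sub>M Z) (px \<Otimes>\<^sub>M pz)"
    by (rule absolutely_continuous_pair_measure[OF sigma_finite_Z _ _ pz_density])
      (simp_all add: sets pz.sigma_finite_measure_axioms)
qed

text \<open>Apart from membership in \<open>cond_densities\<close>, \<open>I\<close> occurs on the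
  right only inside its joint law, including the condition on the critic. An \<open>I\<close> with
  the same joint law can thus be substituted while D stays optimal.\<close>

lemma equilibrium_xz_iff:
  "equilibrium_xz X Y Z px py pz I G D \<longleftrightarrow>
    I \<in> cond_densities X Z \<and> G \<in> generators X Y Z \<and> joint_density px Z I = gen_xz X Z py pz G \<and>
    is_arg_max (\<lambda>D. - enn2ereal (gan_loss (joint_density px Z I) (gen_xz X Z py pz G) D))
      (\<lambda>D. D \<in> critics (X \<Otimes>\<^sub>M Z)) D"
proof -
  obtain I0 where I0: "I0 \<in> cond_densities X Z" "joint_density px Z I0 = gen_xz X Z py pz (\<lambda>_. px)"
    using independent_pair_attains by blast
  have G0: "(\<lambda>_. px) \<in> generators X Y Z" using px_prob by (simp add: generators_def)
  note L = L_xz_eq[OF px_prob py pz sigma_finite_Z]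
  let ?S = "\<lambda>(I, G). I \<in> cond_densities X Z \<and> G \<in> generators X Y Z"
  let ?P = "\<lambda>(I, G). joint_density px Z I" and ?Q = "\<lambda>(I, G). gen_xz X Z py pz G"
  have "is_arg_min (\<lambda>(I, G). SUP D\<in>critics (X \<Otimes>\<^sub>M Z). L_xz Z px py pz I G D) ?S (I, G) \<longleftrightarrow>
     ?S (I, G) \<and> ?P (I, G) = ?Q (I, G)"
  proof (rule is_arg_min_gan_iff[where M = "X \<Otimes>\<^sub>M Z"])
    show "?S (I0, \<lambda>_. px)" "?P (I0, \<lambda>_. px) = ?Q (I0, \<lambda>_. px)"
      using I0 G0 by simp_all
    fix s assume "?S s"
    then obtain I G where s: "s = (I, G)" and I: "I \<in> cond_densities X Z" and G: "G \<in> generators X Y Z"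
      by auto
    show "prob_space (?P s) \<and> sets (?P s) = sets (X \<Otimes>\<^sub>M Z)"
      using prob_algebraD[OF joint_density_in_prob_algebra[OF px_prob sigma_finite_Z I]] by (simp add: s)
    show "prob_space (?Q s) \<and> sets (?Q s) = sets (X \<Otimes>\<^sub>M Z)"
      using prob_algebraD[OF gen_xz_in_prob_algebra(3)[OF G[unfolded generators_def] py pz]] by (simp add: s)
    show "(case s of (I, G) \<Rightarrow> SUP D\<in>critics (X \<Otimes>\<^sub>M Z). L_xz Z px py pz I G D) =
        (SUP D\<in>critics (X \<Otimes>\<^sub>M Z). - enn2ereal (gan_loss (?P s) (?Q s) D))"
      unfolding s prod.case by (intro SUP_cong L[OF I G] refl)
  qed
  moreover have "is_arg_max (L_xz Z px py pz I G) (\<lambda>D. D \<in> critics (X \<Otimes>\<^sub>M Z)) D \<longleftrightarrow>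
      is_arg_max (\<lambda>D. - enn2ereal (gan_loss (joint_density px Z I) (gen_xz X Z py pz G) D))
        (\<lambda>D. D \<in> critics (X \<Otimes>\<^sub>M Z)) D"
    if "I \<in> cond_densities X Z" "G \<in> generators X Y Z"
    using that by (intro is_arg_max_cong L)
  ultimately show ?thesis
    unfolding equilibrium_xz_def by auto
qed

lemma equilibrium_xy_D:
  assumes "equilibrium_xy X Y Z pxy py pz G D"
  shows "gen_xy X Y py pz G = pxy"
proof -
  have T_gen: "T \<in> generators X Y Z" using T by (simp add: generators_def)
  have "is_arg_min (\<lambda>G. SUP D\<in>critics (X \<Otimes>\<^sub>M Y). L_xy pxy py pz G D) (\<lambda>G. G \<in> generators X Y Z) G \<longleftrightarrow>
      G \<in> generators X Y Z \<and> pxy = gen_xy X Y py pz G"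
  proof (rule is_arg_min_gan_iff[where M = "X \<Otimes>\<^sub>M Y" and P = "\<lambda>_. pxy"])
    show "T \<in> generators X Y Z" "pxy = gen_xy X Y py pz T"
      by (rule T_gen, rule pxy)
    show "prob_space pxy \<and> sets pxy = sets (X \<Otimes>\<^sub>M Y)"
      using prob_algebraD[OF pxy_prob] by simp
    show "prob_space (gen_xy X Y py pz G) \<and> sets (gen_xy X Y py pz G) = sets (X \<Otimes>\<^sub>M Y)"
      if "G \<in> generators X Y Z" for G
      using prob_algebraD[OF gen_xy_in_prob_algebra[OF that py pz]] by simp
    show "(SUP D\<in>critics (X \<Otimes>\<^sub>M Y). L_xy pxy py pz G D) =
        (SUP D\<in>critics (X \<Otimes>\<^sub>M Y). - enn2ereal (gan_loss pxy (gen_xy X Y py pz G) D))"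
      if "G \<in> generators X Y Z" for G
      using that by (intro SUP_cong L_xy_eq[OF py pz pxy_prob] refl)
  qed
  then show ?thesis
    using assms by (simp add: equilibrium_xy_def)
qed

lemma equilibrium_xz_minimizes_R_z:
  assumes "equilibrium_xz X Y Z px py pz I G D"
  shows "minimizes_R_z X Z py pz G I"
  using assms gibbs_cond[OF px_prob sigma_finite_Z, of I]
  by (auto simp: equilibrium_xz_iff minimizes_R_z_def is_arg_min_linorder R_z_def)

text \<open>The equilibrium network I is itself a minimizer, so I' has the same objective value, and
  the finite equality case of Gibbs' inequality gives both the same joint law.\<close>

lemma minimizer_R_z_equilibrium_xz:
  assumes eq: "equilibrium_xz X Y Z px py pz I G D" and min: "minimizes_R_z X Z py pz G I'"
    and fin: "\<bar>R_z X Z py pz I' G\<bar> \<noteq> \<infinity>"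
  shows "equilibrium_xz X Y Z px py pz I' G D"
proof -
  have I: "I \<in> cond_densities X Z" and I': "I' \<in> cond_densities X Z"
    and joint: "joint_density px Z I = gen_xz X Z py pz G"
    using eq min by (auto simp: equilibrium_xz_iff minimizes_R_z_def is_arg_min_linorder)
  have "R_z X Z py pz I' G = R_z X Z py pz I G"
    using min equilibrium_xz_minimizes_R_z[OF eq]
    by (auto simp: minimizes_R_z_def is_arg_min_linorder intro: antisym)
  then have "joint_density px Z I' = joint_density px Z I"
    using gibbs_cond_eq[OF px_prob sigma_finite_Z I I'] fin by (simp add: joint R_z_def)
  then show ?thesis
    using eq I' unfolding equilibrium_xz_iff by metis
qed

lemma R_y_equilibrium_xy:
  assumes "equilibrium_xy X Y Z pxy py pz G D"
  shows "R_y X Y pxy py pz C G =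
    eexpect pxy (\<lambda>(x, y). - elog (C x y)) + eexpect pxy (\<lambda>(x, y). - elog (C x y))"
  by (simp add: R_y_def equilibrium_xy_D[OF assms])

lemma posterior_minimizes_R_y:
  assumes eq: "equilibrium_xy X Y Z pxy py pz G D"
    and C: "C \<in> cond_densities X Y" "joint_density px Y C = pxy"
  shows "minimizes_R_y X Y pxy py pz G C"
  using C gibbs_cond[OF px_prob sigma_finite_Y C(1)]
  by (auto simp: minimizes_R_y_def is_arg_min_linorder R_y_equilibrium_xy[OF eq] intro!: add_mono)

lemma exists_posterior: "\<exists>C\<in>cond_densities X Y. joint_density px Y C = pxy"
  by (rule exists_cond_density[OF px_prob sigma_finite_Y pxy_prob px[symmetric] posterior_density])

lemma minimizer_R_y_posterior:
  assumes eq: "equilibrium_xy X Y Z pxy py pz G D" and min: "minimizes_R_y X Y pxy py pz G C"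
    and fin: "\<bar>R_y X Y pxy py pz C G\<bar> \<noteq> \<infinity>"
  shows "joint_density px Y C = pxy"
proof -
  obtain C0 where C0: "C0 \<in> cond_densities X Y" "joint_density px Y C0 = pxy"
    using exists_posterior by blast
  have C: "C \<in> cond_densities X Y"
    using min by (simp add: minimizes_R_y_def is_arg_min_linorder)
  let ?e = "\<lambda>C. eexpect pxy (\<lambda>(x, y). - elog (C x y))"
  have "?e C + ?e C = ?e C0 + ?e C0"
    using min posterior_minimizes_R_y[OF eq C0]
    by (auto simp: minimizes_R_y_def is_arg_min_linorder R_y_equilibrium_xy[OF eq] intro: antisym)
  moreover have "\<bar>?e C + ?e C\<bar> \<noteq> \<infinity>"
    using fin by (simp add: R_y_equilibrium_xy[OF eq])
  \<comment> \<open>Finiteness of the doubled value makes each half finite, so the factor 2 can be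
    cancelled.\<close>
  ultimately have "?e C = ?e C0" "\<bar>?e C\<bar> \<noteq> \<infinity>"
    by (cases "?e C"; cases "?e C0"; simp)+
  then show ?thesis
    using gibbs_cond_eq[OF px_prob sigma_finite_Y C0(1) C] by (simp add: C0)
qed

end

theorem theorem3p3:
  fixes X :: "'x measure" and Y :: "'y measure" and Z :: "'z measure"
    and px :: "'x measure" and py :: "'y measure" and pz :: "'z measure"
    and pxy :: "('x \<times> 'y) measure" and T :: "'y \<times> 'z \<Rightarrow> 'x measure"
  assumes "sgan_setting X Y Z px py pz pxy T"
  shows
    "{(I, G, D). equilibrium_xz X Y Z px py pz I G D \<and> minimizes_R_z X Z py pz G I}
       = {(I, G, D). equilibrium_xz X Y Z px py pz I G D} \<and>
     (\<forall>I G D I'. equilibrium_xz X Y Z px py pz I G D \<and>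
        minimizes_R_z X Z py pz G I' \<and> \<bar>R_z X Z py pz I' G\<bar> \<noteq> \<infinity> \<longrightarrow>
        equilibrium_xz X Y Z px py pz I' G D) \<and>
     {(G, D). equilibrium_xy X Y Z pxy py pz G D \<and> (\<exists>C. minimizes_R_y X Y pxy py pz G C)}
       = {(G, D). equilibrium_xy X Y Z pxy py pz G D} \<and>
     (\<forall>G D C. equilibrium_xy X Y Z pxy py pz G D \<and>
        minimizes_R_y X Y pxy py pz G C \<and> \<bar>R_y X Y pxy py pz C G\<bar> \<noteq> \<infinity> \<longrightarrow>
        joint_density px Y C = pxy \<and> joint_density px Y C = gen_xy X Y py pz G)"
proof -
  interpret sgan_setting X Y Z px py pz pxy T by fact
  \<comment> \<open>\<open>L_xy\<close> does not involve C, so this equality of sets amounts to the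
    existence of a minimizer at every equilibrium; the posterior is one.\<close>
  have "\<exists>C. minimizes_R_y X Y pxy py pz G C" if "equilibrium_xy X Y Z pxy py pz G D" for G D
    using exists_posterior posterior_minimizes_R_y[OF that] by blast
  then have xy: "{(G, D). equilibrium_xy X Y Z pxy py pz G D \<and> (\<exists>C. minimizes_R_y X Y pxy py pz G C)}
      = {(G, D). equilibrium_xy X Y Z pxy py pz G D}"
    by blast
  have xz: "{(I, G, D). equilibrium_xz X Y Z px py pz I G D \<and> minimizes_R_z X Z py pz G I}
      = {(I, G, D). equilibrium_xz X Y Z px py pz I G D}"
    using equilibrium_xz_minimizes_R_z by blast
  show ?thesis
  proof (intro conjI allI impI xz xy; elim conjE)
    fix I G D I'
    assume "equilibrium_xz X Y Z px py pz I G D" "minimizes_R_z X Z py pz G I'" "\<bar>R_z X Z py pz I' G\<bar> \<noteq> \<infinity>"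
    then show "equilibrium_xz X Y Z px py pz I' G D"
      by (rule minimizer_R_z_equilibrium_xz)
  next
    fix G D C
    assume eq: "equilibrium_xy X Y Z pxy py pz G D"
      and "minimizes_R_y X Y pxy py pz G C" "\<bar>R_y X Y pxy py pz C G\<bar> \<noteq> \<infinity>"
    then show "joint_density px Y C = pxy"
      by (rule minimizer_R_y_posterior)
    then show "joint_density px Y C = gen_xy X Y py pz G"
      by (simp add: equilibrium_xy_D[OF eq])
  qed
qed

end
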